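(* In the graceful game, Bob has a winning strategy on every hypercube $Q_n$ with $n\geq 2$ (no matter who starts).
   Context: The hypercube $Q_n$ is defined by $Q_1=K_2$ and $Q_n=K_2\,\square\, Q_{n-1}$ (Cartesian product); it is bipartite, $n$-regular, with $2^n$ vertices and $n2^{n-1}$ edges. A graceful labeling of a graph $G$ with $m$ edges is an injective map $f\colon V(G)\to\{0,1,\dots,m\}$ such that the induced edge labels $|f(u)-f(v)|$, $uv\in E(G)$, are pairwise distinct. The graceful game on a simple graph $G$ with $m$ edges: two players, Alice and Bob, alternately choose a free (not yet labeled) vertex and assign to it a label from $\{0,1,\dots,m\}$ not yet used. An edge both of whose endpoints are labeled gets label $|f(u)-f(v)|$; a move is legal only if after it all edge labels are pairwise distinct. Alice wins if the whole graph ends up gracefully labeled; Bob wins if he can prevent this. Either player may be the first to move. *)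

theory Defs
  imports Main
begin

record 'a graph =
  verts :: "'a set"
  edges :: "'a set set"

definition simple_graph :: "'a graph \<Rightarrow> bool" where
  "simple_graph G \<longleftrightarrow>
     finite (verts G) \<and> (\<forall>e\<in>edges G. e \<subseteq> verts G \<and> card e = 2)"

definition K2 :: "bool graph" where
  "K2 = \<lparr>verts = {False, True}, edges = {{False, True}}\<rparr>"

definition cartesian_product :: "'a graph \<Rightarrow> 'b graph \<Rightarrow> ('a \<times> 'b) graph" where
  "cartesian_product G H = \<lparr>verts = verts G \<times> verts H,
     edges = {{(a, x), (a, y)} | a x y. a \<in> verts G \<and> {x, y} \<in> edges H}
           \<union> {{(a, x), (b, x)} | a b x. {a, b} \<in> edges G \<and> x \<in> verts H}\<rparr>"

definition map_graph :: "('a \<Rightarrow> 'b) \<Rightarrow> 'a graph \<Rightarrow> 'b graph" where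
  "map_graph g G = \<lparr>verts = g ` verts G, edges = (\<lambda>e. g ` e) ` edges G\<rparr>"

text \<open>
  All cubes must live on one vertex type: the vertex \<open>(b, v)\<close> of the product of \<open>K2\<close> with
  the previous cube is encoded as the list \<open>b # v\<close>. The value at dimension \<open>0\<close> (one vertex)
  is only a totality convention.
\<close>

fun hypercube :: "nat \<Rightarrow> bool list graph" where
  "hypercube 0 = \<lparr>verts = {[]}, edges = {}\<rparr>"
| "hypercube (Suc 0) = map_graph (\<lambda>b. [b]) K2"
| "hypercube (Suc (Suc n)) =
     map_graph (\<lambda>(b, v). b # v) (cartesian_product K2 (hypercube (Suc n)))"

definition distinct_edge_labels :: "'a set set \<Rightarrow> ('a \<Rightarrow> nat) \<Rightarrow> bool" where
  "distinct_edge_labels E f \<longleftrightarrow>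
     (\<forall>u v x y. {u, v} \<in> E \<longrightarrow> {x, y} \<in> E \<longrightarrow>
        \<bar>int (f u) - int (f v)\<bar> = \<bar>int (f x) - int (f y)\<bar> \<longrightarrow> {u, v} = {x, y})"

definition graceful_labeling :: "'a graph \<Rightarrow> ('a \<Rightarrow> nat) \<Rightarrow> bool" where
  "graceful_labeling G f \<longleftrightarrow>
     f ` verts G \<subseteq> {0..card (edges G)} \<and> inj_on f (verts G) \<and>
     distinct_edge_labels (edges G) f"


datatype player = Alice | Bob

fun opponent :: "player \<Rightarrow> player" where
  "opponent Alice = Bob"
| "opponent Bob = Alice"

type_synonym 'a position = "'a \<Rightarrow> nat option"
type_synonym 'a move = "'a \<times> nat"

definition make_move :: "'a position \<Rightarrow> 'a move \<Rightarrow> 'a position" where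
  "make_move p mv = p(fst mv \<mapsto> snd mv)"

definition legal_move :: "'a graph \<Rightarrow> 'a position \<Rightarrow> 'a move \<Rightarrow> bool" where
  "legal_move G p mv \<longleftrightarrow>
     fst mv \<in> verts G - dom p \<and>
     snd mv \<in> {0..card (edges G)} - ran p \<and>
     (let p' = make_move p mv in
        distinct_edge_labels {e \<in> edges G. e \<subseteq> dom p'} (\<lambda>v. the (p' v)))"

text \<open>A play is the chronological list of the moves made so far.\<close>

definition position_after :: "'a move list \<Rightarrow> 'a position" where
  "position_after h = foldl make_move Map.empty h"

definition legal_play :: "'a graph \<Rightarrow> 'a move list \<Rightarrow> bool" where
  "legal_play G h \<longleftrightarrow> (\<forall>i<length h. legal_move G (position_after (take i h)) (h ! i))"

definition finished_play :: "'a graph \<Rightarrow> 'a move list \<Rightarrow> bool" where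
  "finished_play G h \<longleftrightarrow> legal_play G h \<and> (\<nexists>mv. legal_move G (position_after h) mv)"

text \<open>The player who makes move number \<open>i\<close> (counted from 0).\<close>

definition turn :: "player \<Rightarrow> nat \<Rightarrow> player" where
  "turn first i = (if even i then first else opponent first)"

definition alice_wins_play :: "'a graph \<Rightarrow> 'a move list \<Rightarrow> bool" where
  "alice_wins_play G h \<longleftrightarrow>
     dom (position_after h) = verts G \<and>
     graceful_labeling G (\<lambda>v. the (position_after h v))"

type_synonym 'a strategy = "'a move list \<Rightarrow> 'a move"

definition follows :: "player \<Rightarrow> player \<Rightarrow> 'a strategy \<Rightarrow> 'a move list \<Rightarrow> bool" where
  "follows first P \<sigma> h \<longleftrightarrow>
     (\<forall>i<length h. turn first i = P \<longrightarrow> h ! i = \<sigma> (take i h))"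

text \<open>
  The first conjunct obliges Bob to move legally whenever a legal move exists; without it he
  could win by proposing an illegal move. A play that gets stuck before every vertex is
  labeled is won by Bob.
\<close>

definition bob_winning_strategy ::
    "'a graph \<Rightarrow> player \<Rightarrow> 'a strategy \<Rightarrow> bool" where
  "bob_winning_strategy G first \<sigma> \<longleftrightarrow>
     (\<forall>h. legal_play G h \<longrightarrow> follows first Bob \<sigma> h \<longrightarrow> turn first (length h) = Bob \<longrightarrow>
        (\<exists>mv. legal_move G (position_after h) mv) \<longrightarrow>
        legal_move G (position_after h) (\<sigma> h)) \<and>
     (\<forall>h. finished_play G h \<longrightarrow> follows first Bob \<sigma> h \<longrightarrow> \<not> alice_wins_play G h)"

lemma verts_hypercube: "verts (hypercube n) = {v. length v = n}"
proof (induction n rule: hypercube.induct)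
  case 1
  show ?case by simp
next
  case 2
  show ?case by (auto simp: map_graph_def K2_def length_Suc_conv)
next
  case (3 n)
  have "{v :: bool list. length v = Suc (Suc n)} = (\<lambda>(b, v). b # v) ` (UNIV \<times> {v. length v = Suc n})"
    by (force simp: length_Suc_conv)
  moreover have "{False, True} = UNIV" by auto
  ultimately show ?case
    using 3 by (simp add: map_graph_def cartesian_product_def K2_def)
qed

lemma simple_graph_hypercube: "simple_graph (hypercube n)"
proof (induction n rule: hypercube.induct)
  case 1
  show ?case by (simp add: simple_graph_def)
next
  case 2
  show ?case by (auto simp: simple_graph_def map_graph_def K2_def)
next
  case (3 n)
  let ?H = "hypercube (Suc n)"
  have H: "finite (verts ?H)" "\<And>x y. {x, y} \<in> edges ?H \<Longrightarrow> x \<in> verts ?H \<and> y \<in> verts ?H \<and> x \<noteq> y"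
    using 3 by (auto simp: simple_graph_def)
  have K: "finite (verts K2)" "\<And>x y. {x, y} \<in> edges K2 \<Longrightarrow> x \<in> verts K2 \<and> y \<in> verts K2 \<and> x \<noteq> y"
    by (auto simp: K2_def doubleton_eq_iff)
  show ?case
    unfolding simple_graph_def hypercube.simps map_graph_def cartesian_product_def graph.simps
    using H K by (fastforce simp: card_insert_if)
qed

end

theory Submission
  imports Defs
begin

text \<open>
  In a graceful labeling every edge label \<open>1, \<dots>, m\<close> occurs. Bob puts \<open>0\<close> on a vertex \<open>z\<close>, next to
  Alice's label if she has already moved; replacing every label \<open>l\<close> by \<open>m - l\<close>, that label may be
  assumed to be at most \<open>m / 2\<close>. The edge label \<open>m\<close> needs \<open>m\<close> on a neighbour of \<open>z\<close>, so Alice must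
  put it there, since otherwise Bob puts \<open>m\<close> elsewhere. Next Bob puts \<open>1\<close> on a neighbour of \<open>z\<close>:
  the hypercube is bipartite, so \<open>1\<close> and \<open>m\<close> are not adjacent, the edge label \<open>m - 1\<close> needs
  \<open>m - 1\<close> on a neighbour of \<open>z\<close>, and Alice's answer is again forced. Continuing with \<open>2, 3, \<dots>\<close> the
  neighbours of \<open>z\<close> run out, and the next label \<open>k\<close> on the side of the neighbours of \<open>z\<close> makes the
  edge label \<open>m - k\<close> impossible. All labelled edges contain \<open>z\<close>, whose label is \<open>0\<close>, so Bob's moves are
  legal. If Alice deviates, there is room for a refutation as soon as \<open>n \<ge> 4\<close>; for \<open>n = 2\<close> and
  \<open>n = 3\<close> the finite game tree is checked by evaluation.
\<close>

section \<open>Positions won by Bob\<close>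

definition unextendable :: "'a graph \<Rightarrow> 'a position \<Rightarrow> bool" where
  "unextendable G p \<longleftrightarrow>
     \<not> (\<exists>f. graceful_labeling G f \<and> (\<forall>v l. p v = Some l \<longrightarrow> f v = l))"

text \<open>The player argument is the one to move. The rule \<open>unextendable\<close> stops the
  analysis as soon as the labels placed rule out every graceful labelling, so the rest of the play
  need not be followed. The conditions \<open>dom p \<noteq> verts G\<close> keep a completed
  position from counting as a position without legal moves.\<close>

inductive bob_wins :: "'a graph \<Rightarrow> player \<Rightarrow> 'a position \<Rightarrow> bool" for G where
  unextendable: "unextendable G p \<Longrightarrow> bob_wins G P p"
| stuck: "dom p \<noteq> verts G \<Longrightarrow> \<nexists>mv. legal_move G p mv \<Longrightarrow> bob_wins G Bob p"
| bob_moves: "legal_move G p mv \<Longrightarrow> bob_wins G Alice (make_move p mv) \<Longrightarrow> bob_wins G Bob p"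
| alice_moves: "dom p \<noteq> verts G \<Longrightarrow>
    (\<And>mv. legal_move G p mv \<Longrightarrow> bob_wins G Bob (make_move p mv)) \<Longrightarrow> bob_wins G Alice p"

lemma unextendable_make_move:
  assumes "unextendable G p" "legal_move G p mv"
  shows "unextendable G (make_move p mv)"
proof -
  have "fst mv \<notin> dom p" using assms(2) by (simp add: legal_move_def)
  hence "p v = Some l \<Longrightarrow> make_move p mv v = Some l" for v l
    by (auto simp: make_move_def)
  thus ?thesis using assms(1) unfolding unextendable_def by blast
qed

text \<open>An unextendable position stays unextendable, so there any legal move keeps the win; the
  other rules either supply the reply or contradict the given legal move.\<close>

lemma bob_wins_BobD:
  assumes "bob_wins G Bob p" "legal_move G p mv"
  shows "\<exists>mv. legal_move G p mv \<and> bob_wins G Alice (make_move p mv)"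
  using assms(1)
proof cases
  case unextendable
  thus ?thesis using unextendable_make_move assms(2) bob_wins.unextendable by blast
qed (use assms(2) in blast)+

lemma bob_wins_AliceD:
  assumes "bob_wins G Alice p" "legal_move G p mv"
  shows "bob_wins G Bob (make_move p mv)"
  using assms(1)
proof cases
  case unextendable
  thus ?thesis using unextendable_make_move assms(2) bob_wins.unextendable by blast
qed (use assms(2) in blast)+

lemma bob_wins_not_graceful:
  assumes "bob_wins G P p" "dom p = verts G"
  shows "\<not> graceful_labeling G (\<lambda>v. the (p v))"
  using assms(1)
proof cases
  case unextendable
  thus ?thesis by (auto simp: unextendable_def)
qed (use assms(2) in \<open>auto simp: legal_move_def\<close>)

section \<open>From won positions to a winning strategy\<close>

lemma position_after_snoc: "position_after (h @ [mv]) = make_move (position_after h) mv"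
  by (simp add: position_after_def)

lemma turn_Suc: "turn P (Suc i) = opponent (turn P i)"
  by (cases P) (auto simp: turn_def)

lemma legal_play_snoc:
  "legal_play G (h @ [mv]) \<longleftrightarrow> legal_play G h \<and> legal_move G (position_after h) mv"
  by (auto simp: legal_play_def nth_append less_Suc_eq)

lemma follows_snoc:
  "follows P Q \<sigma> (h @ [mv]) \<longleftrightarrow>
     follows P Q \<sigma> h \<and> (turn P (length h) = Q \<longrightarrow> mv = \<sigma> h)"
  by (auto simp: follows_def nth_append less_Suc_eq)

lemma bob_winning_strategy_if_bob_wins:
  assumes "bob_wins G first Map.empty"
  shows "\<exists>\<sigma>. bob_winning_strategy G first \<sigma>"
proof -
  \<comment> \<open>The choice is meaningful only where a winning legal reply exists;
    \<open>inv\<close> provides this at every turn of Bob with a legal move.\<close>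
  define \<sigma> where "\<sigma> h = (SOME mv. legal_move G (position_after h) mv \<and>
      bob_wins G Alice (make_move (position_after h) mv))" for h
  have \<sigma>: "legal_move G (position_after h) (\<sigma> h) \<and>
      bob_wins G Alice (make_move (position_after h) (\<sigma> h))"
    if "bob_wins G Bob (position_after h)" "legal_move G (position_after h) mv" for h mv
    unfolding \<sigma>_def using bob_wins_BobD[OF that] by (rule someI_ex)
  have inv: "bob_wins G (turn first (length h)) (position_after h)"
    if "legal_play G h" "follows first Bob \<sigma> h" for h
    using that
  proof (induction h rule: rev_induct)
    case Nil
    thus ?case using assms by (simp add: turn_def position_after_def)
  next
    case (snoc mv h)
    have IH: "bob_wins G (turn first (length h)) (position_after h)"
      and mv: "legal_move G (position_after h) mv"
      and f: "turn first (length h) = Bob \<Longrightarrow> mv = \<sigma> h"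
      using snoc by (auto simp: legal_play_snoc follows_snoc)
    show ?case
    proof (cases "turn first (length h)")
      case Alice
      thus ?thesis using bob_wins_AliceD[of G _ mv] IH mv
        by (simp add: turn_Suc position_after_snoc)
    next
      case Bob
      thus ?thesis using \<sigma>[of h mv] IH mv f by (simp add: turn_Suc position_after_snoc)
    qed
  qed
  have "bob_winning_strategy G first \<sigma>"
    unfolding bob_winning_strategy_def
  proof (intro conjI allI impI)
    fix h assume "legal_play G h" "follows first Bob \<sigma> h" "turn first (length h) = Bob"
      "\<exists>mv. legal_move G (position_after h) mv"
    thus "legal_move G (position_after h) (\<sigma> h)" using inv \<sigma> by metis
  next
    fix h assume "finished_play G h" "follows first Bob \<sigma> h"
    thus "\<not> alice_wins_play G h"
      using inv bob_wins_not_graceful unfolding finished_play_def alice_wins_play_def by blast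
  qed
  thus ?thesis by blast
qed

section \<open>Symmetries of the game\<close>

text \<open>Pullback of the position along \<phi>. For an involution this is the same as moving each
  label from \<open>v\<close> to \<open>\<phi> v\<close>.\<close>

definition relabel :: "('a \<Rightarrow> 'a) \<Rightarrow> (nat \<Rightarrow> nat) \<Rightarrow> 'a position \<Rightarrow> 'a position" where
  "relabel \<phi> g p = (\<lambda>v. map_option g (p (\<phi> v)))"

text \<open>Involutions are their own inverses, so each transfer result yields its converse when
  applied twice. The conditions on \<open>g\<close> concern only labels up to the number of edges,
  since complementation by subtraction truncates beyond it.\<close>

locale game_symmetry =
  fixes G :: "'a graph" and \<phi> :: "'a \<Rightarrow> 'a" and g :: "nat \<Rightarrow> nat"
  assumes simple: "simple_graph G"
    and \<phi>_\<phi>: "\<phi> (\<phi> v) = v"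
    and \<phi>_verts: "v \<in> verts G \<Longrightarrow> \<phi> v \<in> verts G"
    and \<phi>_edges: "{u, v} \<in> edges G \<Longrightarrow> {\<phi> u, \<phi> v} \<in> edges G"
    and g_le: "l \<le> card (edges G) \<Longrightarrow> g l \<le> card (edges G)"
    and g_g: "l \<le> card (edges G) \<Longrightarrow> g (g l) = l"
    and g_dist: "k \<le> card (edges G) \<Longrightarrow> l \<le> card (edges G) \<Longrightarrow>
      \<bar>int (g k) - int (g l)\<bar> = \<bar>int k - int l\<bar>"
begin

abbreviation "m \<equiv> card (edges G)"

text \<open>Two edge sets are allowed so that both partial positions and full labellings are
  covered.\<close>

lemma distinct_edge_labels_transfer:
  assumes "distinct_edge_labels E f"
    and "\<And>u v. {u, v} \<in> E' \<Longrightarrow> {\<phi> u, \<phi> v} \<in> E \<and> f (\<phi> u) \<le> m \<and> f' u = g (f (\<phi> u))"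
  shows "distinct_edge_labels E' f'"
  unfolding distinct_edge_labels_def
proof (intro allI impI)
  fix u v x y
  assume e: "{u, v} \<in> E'" "{x, y} \<in> E'" "\<bar>int (f' u) - int (f' v)\<bar> = \<bar>int (f' x) - int (f' y)\<bar>"
  \<comment> \<open>Reading each edge in reverse order supplies the hypothesis for its second
    endpoint.\<close>
  note a = assms(2)[OF e(1)] assms(2)[OF e(2)]
    assms(2)[of v u] assms(2)[of y x]
  have "\<bar>int (f (\<phi> u)) - int (f (\<phi> v))\<bar> = \<bar>int (f (\<phi> x)) - int (f (\<phi> y))\<bar>"
    using a e by (simp add: insert_commute g_dist)
  hence "{\<phi> u, \<phi> v} = {\<phi> x, \<phi> y}"
    using assms(1) a(1,2) unfolding distinct_edge_labels_def by blast
  hence "\<phi> ` {\<phi> u, \<phi> v} = \<phi> ` {\<phi> x, \<phi> y}" by simp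
  thus "{u, v} = {x, y}" by (simp add: \<phi>_\<phi>)
qed

lemma relabel_relabel: "ran p \<subseteq> {..m} \<Longrightarrow> relabel \<phi> g (relabel \<phi> g p) = p"
  by (rule ext, rename_tac v, case_tac "p v") (auto simp: relabel_def \<phi>_\<phi> g_g ran_def)

lemma relabel_make_move:
  "relabel \<phi> g (make_move p mv) = make_move (relabel \<phi> g p) (\<phi> (fst mv), g (snd mv))"
proof
  fix v
  have "\<phi> v = fst mv \<longleftrightarrow> v = \<phi> (fst mv)" using \<phi>_\<phi> by metis
  thus "relabel \<phi> g (make_move p mv) v = make_move (relabel \<phi> g p) (\<phi> (fst mv), g (snd mv)) v"
    by (auto simp: relabel_def make_move_def)
qed

lemma ran_relabel: "ran p \<subseteq> {..m} \<Longrightarrow> ran (relabel \<phi> g p) \<subseteq> {..m}"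
  by (auto simp: relabel_def ran_def g_le)

lemma dom_relabel: "v \<in> dom (relabel \<phi> g p) \<longleftrightarrow> \<phi> v \<in> dom p"
  by (auto simp: relabel_def)

lemma ran_make_move: "ran p \<subseteq> {..m} \<Longrightarrow> legal_move G p mv \<Longrightarrow> ran (make_move p mv) \<subseteq> {..m}"
  by (auto simp: legal_move_def make_move_def ran_def split: if_splits)

lemma legal_move_relabel:
  assumes "legal_move G p mv" "ran p \<subseteq> {..m}"
  shows "legal_move G (relabel \<phi> g p) (\<phi> (fst mv), g (snd mv))"
proof -
  have mv: "fst mv \<in> verts G" "fst mv \<notin> dom p" "snd mv \<le> m" "snd mv \<notin> ran p"
    using assms(1) by (auto simp: legal_move_def)
  let ?q = "make_move p mv"
  let ?q' = "relabel \<phi> g ?q"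
  have q: "ran ?q \<subseteq> {..m}" using ran_make_move assms by blast
  have "g (snd mv) \<notin> ran (relabel \<phi> g p)"
  proof
    assume "g (snd mv) \<in> ran (relabel \<phi> g p)"
    then obtain v l where "p v = Some l" "g l = g (snd mv)"
      by (auto simp: relabel_def ran_def)
    moreover from this have "l \<le> m" using assms(2) by (auto simp: ran_def)
    ultimately have "l = snd mv" using mv(3) g_g by metis
    thus False using mv(4) \<open>p v = Some l\<close> by (auto simp: ran_def)
  qed
  moreover have "distinct_edge_labels {e \<in> edges G. e \<subseteq> dom ?q'} (\<lambda>v. the (?q' v))"
  proof (rule distinct_edge_labels_transfer)
    show "distinct_edge_labels {e \<in> edges G. e \<subseteq> dom ?q} (\<lambda>v. the (?q v))"
      using assms(1) by (simp add: legal_move_def Let_def)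
    fix u v assume e: "{u, v} \<in> {e \<in> edges G. e \<subseteq> dom ?q'}"
    hence d: "\<phi> u \<in> dom ?q" "\<phi> v \<in> dom ?q" using dom_relabel[of _ ?q] by blast+
    moreover have "the (?q (\<phi> u)) \<le> m" using q d(1) by (auto simp: ran_def)
    moreover have "the (?q' u) = g (the (?q (\<phi> u)))" using d(1) by (auto simp: relabel_def)
    ultimately show "{\<phi> u, \<phi> v} \<in> {e \<in> edges G. e \<subseteq> dom ?q} \<and> the (?q (\<phi> u)) \<le> m \<and>
        the (?q' u) = g (the (?q (\<phi> u)))"
      using e \<phi>_edges by simp
  qed
  ultimately show ?thesis
    using mv \<phi>_verts g_le unfolding legal_move_def Let_def relabel_make_move[symmetric]
    by (auto simp: dom_relabel \<phi>_\<phi>)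
qed

lemma graceful_labeling_relabel:
  assumes "graceful_labeling G f"
  shows "graceful_labeling G (\<lambda>v. g (f (\<phi> v)))"
proof -
  have f: "f v \<le> m" if "v \<in> verts G" for v
    using assms that by (auto simp: graceful_labeling_def)
  have inj: "u = v" if "u \<in> verts G" "v \<in> verts G" "f u = f v" for u v
    using assms that by (auto simp: graceful_labeling_def inj_on_def)
  have E: "u \<in> verts G" "v \<in> verts G" if "{u, v} \<in> edges G" for u v
    using simple that by (auto simp: simple_graph_def)
  have "inj_on (\<lambda>v. g (f (\<phi> v))) (verts G)"
  proof (rule inj_onI)
    fix u v assume uv: "u \<in> verts G" "v \<in> verts G" "g (f (\<phi> u)) = g (f (\<phi> v))"
    hence "f (\<phi> u) = f (\<phi> v)" using g_g f \<phi>_verts by metis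
    hence "\<phi> u = \<phi> v" using inj \<phi>_verts uv by blast
    thus "u = v" using \<phi>_\<phi> by metis
  qed
  moreover have "distinct_edge_labels (edges G) (\<lambda>v. g (f (\<phi> v)))"
    by (rule distinct_edge_labels_transfer[of "edges G" f])
      (use assms f E \<phi>_edges \<phi>_verts in \<open>auto simp: graceful_labeling_def\<close>)
  ultimately show ?thesis
    using f \<phi>_verts g_le by (auto simp: graceful_labeling_def)
qed

lemma unextendable_relabel:
  assumes "unextendable G p" "ran p \<subseteq> {..m}"
  shows "unextendable G (relabel \<phi> g p)"
  unfolding unextendable_def
proof
  assume "\<exists>f. graceful_labeling G f \<and> (\<forall>v l. relabel \<phi> g p v = Some l \<longrightarrow> f v = l)"
  then obtain f where f: "graceful_labeling G f" "\<And>v l. relabel \<phi> g p v = Some l \<Longrightarrow> f v = l"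
    by blast
  have "g (f (\<phi> v)) = l" if "p v = Some l" for v l
  proof -
    have "f (\<phi> v) = g l" using that by (intro f(2)) (simp add: relabel_def \<phi>_\<phi>)
    moreover have "l \<le> m" using assms(2) that by (auto simp: ran_def)
    ultimately show ?thesis by (simp add: g_g)
  qed
  thus False using assms(1) graceful_labeling_relabel[OF f(1)] unfolding unextendable_def by blast
qed

lemma bob_wins_relabel:
  "bob_wins G P p \<Longrightarrow> ran p \<subseteq> {..m} \<Longrightarrow> bob_wins G P (relabel \<phi> g p)"
proof (induction rule: bob_wins.induct)
  case (unextendable p P)
  thus ?case using unextendable_relabel bob_wins.unextendable by blast
next
  case (stuck p)
  have "dom (relabel \<phi> g p) \<noteq> verts G"
    using stuck(1) \<phi>_verts dom_relabel \<phi>_\<phi> by (metis set_eqI)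
  moreover have "\<nexists>mv. legal_move G (relabel \<phi> g p) mv"
    using stuck legal_move_relabel ran_relabel relabel_relabel by metis
  ultimately show ?case by (rule bob_wins.stuck)
next
  case (bob_moves p mv)
  thus ?case
    using bob_wins.bob_moves[OF legal_move_relabel] ran_make_move relabel_make_move by metis
next
  case (alice_moves p)
  show ?case
  proof (rule bob_wins.alice_moves)
    show "dom (relabel \<phi> g p) \<noteq> verts G"
      using alice_moves(1) \<phi>_verts dom_relabel \<phi>_\<phi> by (metis set_eqI)
    fix mv assume mv: "legal_move G (relabel \<phi> g p) mv"
    \<comment> \<open>The symmetry carries Alice's move back to the original position, where the
      induction hypothesis applies.\<close>
    let ?mv = "(\<phi> (fst mv), g (snd mv))"
    have l: "legal_move G p ?mv"
      using legal_move_relabel[OF mv] ran_relabel relabel_relabel alice_moves.prems by metis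
    have "bob_wins G Bob (relabel \<phi> g (make_move p ?mv))"
      using alice_moves.IH[OF l] ran_make_move[OF _ l] alice_moves.prems by blast
    moreover have "snd mv \<le> m" using mv by (simp add: legal_move_def)
    ultimately show "bob_wins G Bob (make_move (relabel \<phi> g p) mv)"
      by (simp add: relabel_make_move \<phi>_\<phi> g_g)
  qed
qed

end

section \<open>Unreachable edge labels\<close>

text \<open>Only injectivity is asked of the extensions: it pins down the vertex carrying a label
  already placed, which is all that the two criteria below exploit.\<close>

definition separated :: "'a graph \<Rightarrow> 'a position \<Rightarrow> nat \<Rightarrow> nat \<Rightarrow> bool" where
  "separated G p a b \<longleftrightarrow> (\<forall>f. inj_on f (verts G) \<longrightarrow> (\<forall>v l. p v = Some l \<longrightarrow> f v = l) \<longrightarrow>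
     (\<forall>u v. {u, v} \<in> edges G \<longrightarrow> \<not> (f u = a \<and> f v = b)))"

lemma separated_commute: "separated G p a b \<Longrightarrow> separated G p b a"
  unfolding separated_def
proof (intro allI impI notI)
  fix f u v
  assume "\<forall>f. inj_on f (verts G) \<longrightarrow> (\<forall>v l. p v = Some l \<longrightarrow> f v = l) \<longrightarrow>
      (\<forall>u v. {u, v} \<in> edges G \<longrightarrow> \<not> (f u = a \<and> f v = b))"
    "inj_on f (verts G)" "\<forall>v l. p v = Some l \<longrightarrow> f v = l" "{u, v} \<in> edges G" "f u = b \<and> f v = a"
  moreover from this(4) have "{v, u} \<in> edges G" by (simp add: insert_commute)
  ultimately show False by blast
qed

lemma separated_if_not_adjacent:
  assumes "simple_graph G" "p u = Some a" "p v = Some b" "{u, v} \<notin> edges G"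
    "u \<in> verts G" "v \<in> verts G"
  shows "separated G p a b"
  unfolding separated_def
proof (intro allI impI notI)
  fix f x y
  assume f: "inj_on f (verts G)" "\<forall>v l. p v = Some l \<longrightarrow> f v = l" "{x, y} \<in> edges G" "f x = a \<and> f y = b"
  have "x \<in> verts G" "y \<in> verts G" using assms(1) f(3) by (auto simp: simple_graph_def)
  moreover have "f u = a" "f v = b" using f(2) assms by auto
  ultimately have "x = u" "y = v" using inj_onD[OF f(1)] f(4) assms(5,6) by metis+
  thus False using f(3) assms(4) by simp
qed

text \<open>By injectivity \<open>u\<close> is the only vertex with label \<open>a\<close>, and none
  of its neighbours can still receive \<open>b\<close>.\<close>

lemma separated_if_neighbours_labelled:
  assumes "simple_graph G" "p u = Some a" "u \<in> verts G"
    "\<And>v. {u, v} \<in> edges G \<Longrightarrow> v \<in> dom p \<and> p v \<noteq> Some b"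
  shows "separated G p a b"
  unfolding separated_def
proof (intro allI impI notI)
  fix f x y
  assume f: "inj_on f (verts G)" "\<forall>v l. p v = Some l \<longrightarrow> f v = l" "{x, y} \<in> edges G" "f x = a \<and> f y = b"
  have "x \<in> verts G" using assms(1) f(3) by (auto simp: simple_graph_def)
  moreover have "f u = a" using f(2) assms by auto
  ultimately have "x = u" using inj_onD[OF f(1)] f(4) assms(3) by metis
  thus False using f assms(4)[of y] by auto
qed

text \<open>Pigeonhole: the edge labels are distinct, lie between 1 and the number of edges, and are
  as many as the edges.\<close>

lemma edge_labels_graceful:
  assumes "simple_graph G" "graceful_labeling G f" "1 \<le> M" "M \<le> card (edges G)"
  shows "\<exists>u v. {u, v} \<in> edges G \<and> f u + M = f v"
proof -
  let ?m = "card (edges G)"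
  \<comment> \<open>Maximum minus minimum makes the edge label a function of the edge as a set, with
    no orientation to choose.\<close>
  define lab where "lab e = Max (f ` e) - Min (f ` e)" for e
  have E: "e \<subseteq> verts G \<and> card e = 2" if "e \<in> edges G" for e
    using assms(1) that by (auto simp: simple_graph_def)
  have lab: "\<exists>u v. e = {u, v} \<and> f u < f v \<and> lab e = f v - f u \<and> f v \<le> ?m" if e: "e \<in> edges G" for e
  proof -
    obtain x y where xy: "e = {x, y}" "x \<noteq> y" using E[OF e] by (meson card_2_iff)
    have "f x \<noteq> f y"
      using xy assms(2) E[OF e] by (auto simp: graceful_labeling_def inj_on_def)
    then obtain u v where uv: "e = {u, v}" "f u < f v"
      using xy by (metis insert_commute linorder_neqE_nat)
    moreover have "f v \<le> ?m"
      using assms(2) E[OF e] uv by (auto simp: graceful_labeling_def)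
    moreover have "lab e = f v - f u" using uv by (simp add: lab_def max_def min_def)
    ultimately show ?thesis by blast
  qed
  have "inj_on lab (edges G)"
  proof (rule inj_onI)
    fix d e assume de: "d \<in> edges G" "e \<in> edges G" "lab d = lab e"
    obtain u v where d: "d = {u, v}" "f u < f v" "lab d = f v - f u" using lab[OF de(1)] by blast
    obtain x y where e: "e = {x, y}" "f x < f y" "lab e = f y - f x" using lab[OF de(2)] by blast
    have "\<bar>int (f u) - int (f v)\<bar> = \<bar>int (f x) - int (f y)\<bar>" using d e de(3) by linarith
    thus "d = e" using assms(2) d(1) e(1) de(1,2)
      unfolding graceful_labeling_def distinct_edge_labels_def by blast
  qed
  moreover have "lab ` edges G \<subseteq> {1..?m}"
  proof
    fix l assume "l \<in> lab ` edges G"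
    then obtain e where e: "e \<in> edges G" "l = lab e" by blast
    obtain u v where "f u < f v" "lab e = f v - f u" "f v \<le> ?m" using lab[OF e(1)] by blast
    thus "l \<in> {1..?m}" using e(2) by auto
  qed
  \<comment> \<open>An infinite set has cardinality 0, so the bounds on \<open>M\<close> force
    finiteness.\<close>
  moreover have "finite (edges G)" using assms(3,4) by (intro card_ge_0_finite) linarith
  ultimately have "lab ` edges G = {1..?m}"
    by (intro card_subset_eq) (simp_all add: card_image)
  hence "M \<in> lab ` edges G" using assms(3,4) by simp
  then obtain e where e: "e \<in> edges G" "lab e = M" by blast
  obtain u v where "e = {u, v}" "f u < f v" "lab e = f v - f u" using lab[OF e(1)] by blast
  hence "{u, v} \<in> edges G" "f u + M = f v" using e by auto
  thus ?thesis by blast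
qed

text \<open>The edge label \<open>M\<close> can only come from labels \<open>i\<close> and
  \<open>i + M\<close>; once all these pairs are blocked, a value that every graceful labelling
  attains is missing.\<close>

lemma unextendable_if_separated:
  assumes "simple_graph G" "1 \<le> M" "M \<le> card (edges G)"
    "\<And>i. i + M \<le> card (edges G) \<Longrightarrow> separated G p i (i + M)"
  shows "unextendable G p"
  unfolding unextendable_def
proof
  assume "\<exists>f. graceful_labeling G f \<and> (\<forall>v l. p v = Some l \<longrightarrow> f v = l)"
  then obtain f where f: "graceful_labeling G f" "\<forall>v l. p v = Some l \<longrightarrow> f v = l" by blast
  obtain u v where uv: "{u, v} \<in> edges G" "f u + M = f v"
    using edge_labels_graceful[OF assms(1) f(1) assms(2,3)] by blast
  have "v \<in> verts G" using assms(1) uv(1) by (auto simp: simple_graph_def)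
  hence "f u + M \<le> card (edges G)" using f(1) uv(2) by (auto simp: graceful_labeling_def)
  from assms(4)[OF this] show False
    using f uv unfolding separated_def graceful_labeling_def by metis
qed

text \<open>Without a labelled neighbour the move completes no edge, so no new edge label
  arises.\<close>

lemma legal_move_isolated:
  assumes "simple_graph G"
    "distinct_edge_labels {e \<in> edges G. e \<subseteq> dom p} (\<lambda>v. the (p v))"
    "s \<in> verts G" "s \<notin> dom p" "l \<le> card (edges G)" "l \<notin> ran p"
    "\<And>v. v \<in> dom p \<Longrightarrow> {s, v} \<notin> edges G"
  shows "legal_move G p (s, l)"
proof -
  let ?q = "make_move p (s, l)"
  have s: "s \<notin> e" if "e \<in> edges G" "e \<subseteq> dom ?q" for e
  proof
    assume "s \<in> e"
    have "card e = 2" using assms(1) that(1) by (auto simp: simple_graph_def)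
    then obtain v where "e = {s, v}" "v \<noteq> s" using \<open>s \<in> e\<close> by (auto simp: card_2_iff)
    moreover from this have "v \<in> dom p" using that(2) by (auto simp: make_move_def)
    ultimately show False using assms(7) that(1) by blast
  qed
  have E: "{e \<in> edges G. e \<subseteq> dom ?q} = {e \<in> edges G. e \<subseteq> dom p}"
    using s by (auto simp: make_move_def)
  have "distinct_edge_labels {e \<in> edges G. e \<subseteq> dom p} (\<lambda>v. the (?q v))"
    using assms(2,4) unfolding distinct_edge_labels_def by (auto simp: make_move_def)
  thus ?thesis using assms by (simp add: legal_move_def Let_def E)
qed

text \<open>Every labelled edge contains the vertex labelled 0, so its edge label is the label of
  the other endpoint, and injectivity applies.\<close>

lemma distinct_edge_labels_star:
  assumes "p z = Some 0" "inj_on p (dom p)"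
    "\<And>u v. {u, v} \<in> edges G \<Longrightarrow> u \<in> dom p \<Longrightarrow> v \<in> dom p \<Longrightarrow> z = u \<or> z = v"
  shows "distinct_edge_labels {e \<in> edges G. e \<subseteq> dom p} (\<lambda>v. the (p v))"
proof -
  have *: "\<exists>w. {u, v} = {z, w} \<and> w \<in> dom p \<and> \<bar>int (the (p u)) - int (the (p v))\<bar> = int (the (p w))"
    if "{u, v} \<in> edges G" "u \<in> dom p" "v \<in> dom p" for u v
    using assms(1) assms(3)[OF that] that by (auto simp: insert_commute)
  show ?thesis
    unfolding distinct_edge_labels_def
  proof (intro allI impI)
    fix u v x y
    assume e: "{u, v} \<in> {e \<in> edges G. e \<subseteq> dom p}" "{x, y} \<in> {e \<in> edges G. e \<subseteq> dom p}"
      "\<bar>int (the (p u)) - int (the (p v))\<bar> = \<bar>int (the (p x)) - int (the (p y))\<bar>"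
    obtain w where w: "{u, v} = {z, w}" "w \<in> dom p"
      "\<bar>int (the (p u)) - int (the (p v))\<bar> = int (the (p w))" using *[of u v] e(1) by auto
    obtain t where t: "{x, y} = {z, t}" "t \<in> dom p"
      "\<bar>int (the (p x)) - int (the (p y))\<bar> = int (the (p t))" using *[of x y] e(2) by auto
    have "p w = p t" using w t e(3) by auto
    hence "w = t" using assms(2) w(2) t(2) by (auto simp: inj_on_def)
    thus "{u, v} = {x, y}" using w t by simp
  qed
qed

section \<open>The hypercube\<close>

fun adj :: "bool list \<Rightarrow> bool list \<Rightarrow> bool" where
  "adj (a # u) (b # v) = (if a = b then adj u v else u = v)"
| "adj _ _ = False"

fun nbrs :: "bool list \<Rightarrow> bool list list" where
  "nbrs [] = []"
| "nbrs (b # u) = ((\<not> b) # u) # map ((#) b) (nbrs u)"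

fun parity :: "bool list \<Rightarrow> bool" where
  "parity [] = False"
| "parity (b # u) = (b \<noteq> parity u)"

lemma adj_commute: "adj u v \<longleftrightarrow> adj v u"
  by (induction u v rule: adj.induct) auto

lemma adj_length: "adj u v \<Longrightarrow> length v = length u"
  by (induction u v rule: adj.induct) (auto split: if_splits)

lemma adj_parity: "adj u v \<Longrightarrow> parity v \<noteq> parity u"
  by (induction u v rule: adj.induct) (auto split: if_splits)

lemma not_adj_refl: "\<not> adj u u"
  using adj_parity by blast

lemma set_nbrs: "set (nbrs u) = {v. adj u v}"
proof (induction u)
  case (Cons a u)
  have "v \<in> set (nbrs (a # u)) \<longleftrightarrow> adj (a # u) v" for v
    using Cons by (cases v) auto
  thus ?case by blast
qed simp

lemma distinct_nbrs: "distinct (nbrs u)"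
  by (induction u) (auto simp: distinct_map)

lemma length_nbrs: "length (nbrs u) = length u"
  by (induction u) auto

lemma card_adj: "card {v. adj u v} = length u"
  using distinct_card[OF distinct_nbrs[of u]] by (simp add: set_nbrs length_nbrs)

lemma finite_adj: "finite {v. adj u v}"
  by (metis List.finite_set set_nbrs)

lemma card_lists: "card {v :: bool list. length v = n} = 2 ^ n"
  using card_lists_length_eq[of "UNIV :: bool set" n] by simp

lemma finite_lists: "finite {v :: bool list. length v = n}"
  using finite_lists_length_eq[of "UNIV :: bool set" n] by simp

text \<open>The first bit is determined by the tail and the prescribed parity, so there are as many
  such lists as tails.\<close>

lemma card_parity: "card {v. length v = Suc n \<and> parity v = b} = 2 ^ n"
proof -
  let ?A = "\<lambda>b. {v. length v = n \<and> parity v = b}"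
  have "{v. length v = Suc n \<and> parity v = b} = (#) False ` ?A b \<union> (#) True ` ?A (\<not> b)"
    by (auto simp: length_Suc_conv image_iff)
  moreover have fin: "finite (?A c)" for c by (rule finite_subset[OF _ finite_lists[of n]]) auto
  ultimately have "card {v. length v = Suc n \<and> parity v = b} = card (?A b) + card (?A (\<not> b))"
    by (simp, subst card_Un_disjoint) (auto simp: card_image)
  also have "\<dots> = card (?A b \<union> ?A (\<not> b))"
    using fin by (intro card_Un_disjoint[symmetric]) auto
  also have "?A b \<union> ?A (\<not> b) = {v. length v = n}" by auto
  finally show ?thesis by (simp add: card_lists)
qed

section \<open>Edges of the hypercube\<close>

lemma edges_hypercube_Suc:
  "edges (hypercube (Suc (Suc n))) =
     (`) ((#) False) ` edges (hypercube (Suc n)) \<union> (`) ((#) True) ` edges (hypercube (Suc n)) \<union>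
     (\<lambda>v. {False # v, True # v}) ` {v. length v = Suc n}"
proof -
  let ?H = "hypercube (Suc n)"
  let ?c = "\<lambda>(b, v). b # v"
  have H: "\<exists>x y. e = {x, y}" if "e \<in> edges ?H" for e
    using simple_graph_hypercube[of "Suc n"] that
    unfolding simple_graph_def by (meson card_2_iff)
  define A where "A = {{(a, x), (a, y)} | (a :: bool) x y. {x, y} \<in> edges ?H}"
  define B where "B = {{(a, x), (b, x)} | (a :: bool) b (x :: bool list). {a, b} = {False, True} \<and> length x = Suc n}"
  have "verts K2 = UNIV" by (auto simp: K2_def)
  hence "edges (hypercube (Suc (Suc n))) = (\<lambda>e. ?c ` e) ` A \<union> (\<lambda>e. ?c ` e) ` B"
    by (simp add: map_graph_def cartesian_product_def verts_hypercube A_def B_def image_Un K2_def)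
  also have "(\<lambda>e. ?c ` e) ` A = {{a # x, a # y} | a x y. {x, y} \<in> edges ?H}"
  proof (intro equalityI subsetI)
    fix e assume "e \<in> (\<lambda>e. ?c ` e) ` A"
    then obtain a x y where "e = ?c ` {(a, x), (a, y)}" "{x, y} \<in> edges ?H" unfolding A_def by blast
    thus "e \<in> {{a # x, a # y} | a x y. {x, y} \<in> edges ?H}" by auto
  next
    fix e assume "e \<in> {{a # x, a # y} | a x y. {x, y} \<in> edges ?H}"
    then obtain a x y where "e = ?c ` {(a, x), (a, y)}" "{x, y} \<in> edges ?H" by auto
    thus "e \<in> (\<lambda>e. ?c ` e) ` A" unfolding A_def by blast
  qed
  also have "(\<lambda>e. ?c ` e) ` B = (\<lambda>v. {False # v, True # v}) ` {v. length v = Suc n}"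
  proof (intro equalityI subsetI)
    fix e assume "e \<in> (\<lambda>e. ?c ` e) ` B"
    then obtain a b x where "e = ?c ` {(a, x), (b, x)}" "{a, b} = {False, True}" "length x = Suc n"
      unfolding B_def by blast
    moreover from this have "e = {False # x, True # x}" by (cases a) auto
    ultimately show "e \<in> (\<lambda>v. {False # v, True # v}) ` {v. length v = Suc n}" by blast
  next
    fix e assume "e \<in> (\<lambda>v. {False # v, True # v}) ` {v. length v = Suc n}"
    then obtain x where "e = ?c ` {(False, x), (True, x)}" "length x = Suc n" by auto
    thus "e \<in> (\<lambda>e. ?c ` e) ` B" unfolding B_def by blast
  qed
  also have "{{a # x, a # y} | a x y. {x, y} \<in> edges ?H} =
      (`) ((#) False) ` edges ?H \<union> (`) ((#) True) ` edges ?H"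
  proof (intro equalityI subsetI)
    fix e assume "e \<in> {{a # x, a # y} | a x y. {x, y} \<in> edges ?H}"
    then obtain a x y where "e = (#) a ` {x, y}" "{x, y} \<in> edges ?H" by auto
    hence "e \<in> (`) ((#) a) ` edges ?H" by blast
    thus "e \<in> (`) ((#) False) ` edges ?H \<union> (`) ((#) True) ` edges ?H" by (cases a) simp_all
  next
    fix e assume "e \<in> (`) ((#) False) ` edges ?H \<union> (`) ((#) True) ` edges ?H"
    then obtain a d where d: "e = (#) a ` d" "d \<in> edges ?H" by (elim UnE imageE)
    obtain x y where "d = {x, y}" using H[OF d(2)] by blast
    thus "e \<in> {{a # x, a # y} | a x y. {x, y} \<in> edges ?H}" using d by auto
  qed
  finally show ?thesis .
qed

text \<open>The recursive product is replaced by Hamming distance one; \<open>adj\<close> forces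
  equal lengths, so one length condition suffices.\<close>

lemma edge_hypercube_iff: "{u, v} \<in> edges (hypercube n) \<longleftrightarrow> length u = n \<and> adj u v"
proof (induction n arbitrary: u v rule: hypercube.induct)
  case 1
  show ?case by (cases u) auto
next
  case 2
  show ?case
    by (cases u; cases v)
      (auto simp: map_graph_def K2_def doubleton_eq_iff length_Suc_conv split: if_splits)
next
  case (3 n)
  let ?H = "hypercube (Suc n)"
  have img: "{u, v} \<in> (`) ((#) a) ` edges ?H \<longleftrightarrow>
      (\<exists>x y. u = a # x \<and> v = a # y \<and> {x, y} \<in> edges ?H)" (is "?l \<longleftrightarrow> ?r") for a
  proof
    assume ?l
    then obtain d where d: "{u, v} = (#) a ` d" "d \<in> edges ?H" by blast
    have "u \<in> (#) a ` d" "v \<in> (#) a ` d" unfolding d(1)[symmetric] by simp_all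
    then obtain x y where "u = a # x" "v = a # y" by blast
    moreover from this d(1) have "(#) a ` d = (#) a ` {x, y}" by simp
    hence "d = {x, y}" by (subst (asm) inj_image_eq_iff) (auto intro: injI)
    ultimately show ?r using d(2) by blast
  next
    assume ?r
    then obtain x y where "{u, v} = (#) a ` {x, y}" "{x, y} \<in> edges ?H" by auto
    thus ?l by blast
  qed
  have mat: "{u, v} \<in> (\<lambda>v. {False # v, True # v}) ` {v. length v = Suc n} \<longleftrightarrow>
      (\<exists>x. length x = Suc n \<and> (u = False # x \<and> v = True # x \<or> u = True # x \<and> v = False # x))"
    by (auto simp: image_iff doubleton_eq_iff)
  note iff = edges_hypercube_Suc[of n] Un_iff img mat "3.IH"
  show ?case
  proof (cases "u = [] \<or> v = []")
    case True
    thus ?thesis unfolding iff by (cases u) auto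
  next
    case False
    then obtain a x b y where uv: "u = a # x" "v = b # y" by (cases u; cases v) auto
    show ?thesis unfolding iff by (cases a; cases b) (auto simp: uv)
  qed
qed

lemma finite_edges_hypercube: "finite (edges (hypercube n))"
proof -
  have "edges (hypercube n) \<subseteq> Pow (verts (hypercube n))"
    using simple_graph_hypercube[of n] by (auto simp: simple_graph_def)
  thus ?thesis by (rule finite_subset) (simp add: verts_hypercube finite_lists)
qed

lemma card_edges_hypercube: "card (edges (hypercube (Suc n))) = Suc n * 2 ^ n"
proof (induction n)
  case 0
  show ?case by (simp add: map_graph_def K2_def)
next
  case (Suc n)
  let ?E = "edges (hypercube (Suc n))"
  let ?M = "(\<lambda>v. {False # v, True # v}) ` {v :: bool list. length v = Suc n}"
  have c: "card ((`) ((#) a) ` ?E) = card ?E" for a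
    by (intro card_image inj_onI) (subst (asm) inj_image_eq_iff, auto intro: injI)
  have "inj_on (\<lambda>v. {False # v, True # v}) {v :: bool list. length v = Suc n}"
    by (auto intro!: inj_onI simp: doubleton_eq_iff)
  hence M: "card ?M = 2 ^ Suc n" by (simp add: card_image card_lists)
  have ne: "e \<noteq> {}" if "e \<in> ?E" for e
    using simple_graph_hypercube[of "Suc n"] that by (auto simp: simple_graph_def)
  \<comment> \<open>Disjointness rests on edges being nonempty: the empty set would have the same
    image under both prefixes.\<close>
  have FT: "(`) ((#) False) ` ?E \<inter> (`) ((#) True) ` ?E = {}"
  proof -
    have "(#) False ` d \<noteq> (#) True ` e" if "d \<in> ?E" for d e using ne[OF that] by blast
    thus ?thesis by blast
  qed
  \<comment> \<open>An edge between the copies shows both first bits, an edge inside a copy only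
    one.\<close>
  have "(`) ((#) a) ` ?E \<inter> ?M = {}" for a
  proof -
    have "(#) a ` d \<noteq> {False # v, True # v}" for d v
    proof
      assume "(#) a ` d = {False # v, True # v}"
      hence "(\<not> a) # v \<in> (#) a ` d" by (cases a) simp_all
      thus False by auto
    qed
    thus ?thesis by blast
  qed
  hence "card (edges (hypercube (Suc (Suc n)))) = card ?E + card ?E + 2 ^ Suc n"
    unfolding edges_hypercube_Suc
    by (subst card_Un_disjoint; (subst card_Un_disjoint)?)
      (auto simp: FT c M Int_Un_distrib2 finite_edges_hypercube finite_lists)
  thus ?case by (simp only: Suc.IH) (simp add: algebra_simps)
qed

text \<open>If \<open>r\<close> and \<open>t\<close> arise from \<open>z\<close> by flipping one bit
  each, \<open>s\<close> arises by flipping both bits.\<close>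

lemma ex_common_neighbour:
  assumes "adj z r" "adj z t" "r \<noteq> t"
  shows "\<exists>s. s \<noteq> z \<and> adj s r \<and> adj s t \<and> (\<forall>v. adj z v \<longrightarrow> adj s v \<longrightarrow> v = r \<or> v = t)"
  using assms
proof (induction z arbitrary: r t)
  case (Cons a z)
  obtain b r' c t' where rt: "r = b # r'" "t = c # t'"
    using Cons.prems by (metis adj.simps(3) neq_Nil_conv)
  \<comment> \<open>The case in which one of the two flipped bits is the first one.\<close>
  have mixed: "\<exists>s. s \<noteq> a # z \<and> adj s ((\<not> a) # z) \<and> adj s (a # y) \<and>
      (\<forall>v. adj (a # z) v \<longrightarrow> adj s v \<longrightarrow> v = (\<not> a) # z \<or> v = a # y)" if "adj z y" for y
  proof (intro exI conjI allI impI)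
    show "adj ((\<not> a) # y) ((\<not> a) # z)" using that adj_commute by simp
    fix v assume "adj (a # z) v" "adj ((\<not> a) # y) v"
    thus "v = (\<not> a) # z \<or> v = a # y" by (cases v) (auto split: if_splits)
  qed auto
  consider "b \<noteq> a" "c = a" | "b = a" "c \<noteq> a" | "b = a" "c = a"
    using Cons.prems rt by (cases "b = a"; cases "c = a") auto
  thus ?case
  proof cases
    case 1
    thus ?thesis using mixed[of t'] Cons.prems rt by auto
  next
    case 2
    thus ?thesis using mixed[of r'] Cons.prems rt by auto
  next
    case 3
    then obtain s where "s \<noteq> z" "adj s r'" "adj s t'" "\<forall>v. adj z v \<longrightarrow> adj s v \<longrightarrow> v = r' \<or> v = t'"
      using Cons.IH[of r' t'] Cons.prems rt by auto
    moreover have "v = r \<or> v = t" if "adj (a # z) v" "adj (a # s) v" for v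
      using that calculation 3 rt by (cases v) (auto split: if_splits)
    ultimately show ?thesis using 3 rt by (intro exI[of _ "a # s"]) auto
  qed
qed simp

section \<open>Translations of the hypercube and Alice's opening move\<close>

fun translate :: "bool list \<Rightarrow> bool list \<Rightarrow> bool list" where
  "translate (a # t) (b # u) = (a \<noteq> b) # translate t u"
| "translate _ u = u"

lemma translate_translate: "translate t (translate t u) = u"
  by (induction t u rule: translate.induct) auto

lemma length_translate: "length (translate t u) = length u"
  by (induction t u rule: translate.induct) auto

lemma translate_zero: "translate t (replicate (length t) False) = t"
  by (induction t) auto

lemma adj_translate: "adj (translate t u) (translate t v) \<longleftrightarrow> adj u v"
proof (induction u v arbitrary: t rule: adj.induct)
  case (1 a u b v)
  have "translate s u = translate s v \<longleftrightarrow> u = v" for s using translate_translate by metis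
  thus ?case using 1 by (cases t) auto
next
  case ("2_1" v)
  show ?case by (cases t) auto
next
  case ("2_2" u)
  show ?case by (cases t; cases u) auto
qed

text \<open>\<open>translate\<close> is coordinatewise exclusive or, an involutive automorphism;
  complementing the labels preserves all differences.\<close>

lemma hypercube_symmetry:
  assumes "g = id \<or> g = (\<lambda>l. card (edges (hypercube n)) - l)"
  shows "game_symmetry (hypercube n) (translate t) g"
  using assms simple_graph_hypercube
  by unfold_locales
    (auto simp: verts_hypercube edge_hypercube_iff translate_translate length_translate adj_translate)

text \<open>Translation by \<open>v\<close> exchanges \<open>v\<close> with the zero vertex, and
  complementation brings a large label down to at most half the number of edges.\<close>

lemma bob_wins_single:
  assumes v: "length v = n" and x: "x \<le> card (edges (hypercube n))"
    and w: "\<And>x. x \<le> card (edges (hypercube n)) div 2 \<Longrightarrow>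
      bob_wins (hypercube n) Bob [replicate n False \<mapsto> x]"
  shows "bob_wins (hypercube n) Bob [v \<mapsto> x]"
proof -
  let ?G = "hypercube n" and ?m = "card (edges (hypercube n))" and ?o = "replicate n False"
  have \<phi>: "translate v u = ?o \<longleftrightarrow> u = v" for u
    using translate_translate translate_zero v by metis
  have *: "bob_wins ?G Bob [v \<mapsto> g y]"
    if "g = id \<or> g = (\<lambda>l. ?m - l)" "y \<le> ?m div 2" for g y
  proof -
    interpret game_symmetry ?G "translate v" g using hypercube_symmetry that(1) by blast
    have "bob_wins ?G Bob (relabel (translate v) g [?o \<mapsto> y])"
      by (rule bob_wins_relabel[OF w[OF that(2)]]) (use that(2) in auto)
    moreover have "relabel (translate v) g [?o \<mapsto> y] = [v \<mapsto> g y]"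
      unfolding relabel_def using \<phi> by (intro ext) (simp add: fun_upd_def)
    ultimately show ?thesis by simp
  qed
  show ?thesis
  proof (cases "x \<le> ?m div 2")
    case True
    thus ?thesis using *[of id x] by simp
  next
    case False
    thus ?thesis using *[of "\<lambda>l. ?m - l" "?m - x"] x by force
  qed
qed

lemma bob_wins_Alice_first:
  assumes "\<And>x. x \<le> card (edges (hypercube n)) div 2 \<Longrightarrow>
      bob_wins (hypercube n) Bob [replicate n False \<mapsto> x]"
  shows "bob_wins (hypercube n) Alice Map.empty"
proof (rule alice_moves)
  show "dom Map.empty \<noteq> verts (hypercube n)"
    by (auto simp: verts_hypercube intro: exI[of _ "replicate n False"])
  fix mv assume "legal_move (hypercube n) Map.empty mv"
  thus "bob_wins (hypercube n) Bob (make_move Map.empty mv)"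
    using bob_wins_single[of "fst mv" n "snd mv"] assms
    by (auto simp: legal_move_def verts_hypercube make_move_def)
qed

section \<open>Dimension at least four\<close>

text \<open>This is where dimension four enters: equality holds at 4, and the bound fails at 3. It
  makes each class of the bipartition at least twice as large as a neighbourhood.\<close>

lemma double_le_power: "4 \<le> n \<Longrightarrow> 2 * n \<le> 2 ^ (n - 1)" for n :: nat
proof (induction n rule: nat_induct_at_least)
  case (Suc n)
  then obtain k where "n = Suc k" by (cases n) auto
  thus ?case using Suc by simp
qed simp

lemma inj_on_map_upd:
  assumes "inj_on p (dom p)" "l \<notin> ran p"
  shows "inj_on (p(v \<mapsto> l)) (dom (p(v \<mapsto> l)))"
  using assms by (auto simp: inj_on_def ran_def)

text \<open>Vertices in the class opposite to \<open>z\<close> are pairwise non-adjacent, so no edge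
  joins two labels of this kind.\<close>

definition off_parity :: "bool list \<Rightarrow> bool list position \<Rightarrow> nat \<Rightarrow> bool" where
  "off_parity z p l \<longleftrightarrow> (\<exists>v. p v = Some l \<and> length v = length z \<and> parity v \<noteq> parity z)"

lemma off_parity_mono:
  "off_parity z p l \<Longrightarrow> (\<And>v l. p v = Some l \<Longrightarrow> q v = Some l) \<Longrightarrow> off_parity z q l"
  unfolding off_parity_def by blast

locale star =
  fixes n m :: nat and z :: "bool list"
  assumes n: "4 \<le> n" and z: "length z = n" and m: "m = card (edges (hypercube n))"
begin

abbreviation "G \<equiv> hypercube n"

abbreviation "N \<equiv> {v. adj z v}"

text \<open>
  Labels \<open>1, \<dots>, k\<close> and \<open>m - k + 1, \<dots>, m\<close> sit on neighbours of \<open>z\<close>, hence pairwise non-adjacent, so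
  the edge label \<open>m - k\<close> can only arise from the label \<open>m - k\<close> on a neighbour of \<open>z\<close>. The
  alternative \<open>l \<le> m div 2\<close> is for the label Alice may have chosen before Bob's first move.
\<close>

definition star_position :: "nat \<Rightarrow> bool list position \<Rightarrow> bool" where
  "star_position k p \<longleftrightarrow> p z = Some 0 \<and> dom p \<subseteq> insert z N \<and> inj_on p (dom p) \<and>
     {1..k} \<subseteq> ran p \<and> {m - k<..m} \<subseteq> ran p \<and>
     (\<forall>l\<in>ran p. l \<le> k \<or> m - k < l \<or> l \<le> m div 2)"

text \<open>Keeps the small and the large labels of a star apart, and leaves a spare label when
  \<open>n + 3\<close> labels are excluded.\<close>

lemma m_bound: "n + 4 \<le> m"
proof -
  obtain k where k: "n = Suc k" using n by (cases n) auto
  have "n + 4 \<le> 2 * n" using n by simp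
  also have "\<dots> \<le> n * 2 ^ k" using n k double_le_power[OF n] by simp
  also have "\<dots> = m" by (simp only: m k card_edges_hypercube)
  finally show ?thesis .
qed

lemma card_N: "card N = n"
  using card_adj z by simp

lemma card_opposite: "2 * n \<le> card {v. length v = n \<and> parity v \<noteq> parity z}"
proof -
  obtain k where k: "n = Suc k" using n by (cases n) auto
  have "{v. length v = n \<and> parity v \<noteq> parity z} = {v. length v = Suc k \<and> parity v = (\<not> parity z)}"
    using k by auto
  thus ?thesis using double_le_power[OF n] k by (simp only: card_parity) simp
qed

lemma ex_opposite_outside:
  assumes "finite A" "card A < 2 * n"
  shows "\<exists>s. length s = n \<and> parity s \<noteq> parity z \<and> s \<notin> A"
proof (rule ccontr)
  assume "\<not> ?thesis"
  hence "{v. length v = n \<and> parity v \<noteq> parity z} \<subseteq> A" by blast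
  hence "2 * n \<le> card A" using card_mono[OF assms(1)] card_opposite le_trans by blast
  thus False using assms(2) by simp
qed

text \<open>For positive \<open>i\<close> both labels lie in one class of the bipartition and span
  no edge, so only the pair of 0 and \<open>M\<close> has to be blocked separately.\<close>

lemma unextendable_if_off_parity:
  assumes "1 \<le> M" "M \<le> m" "separated G p 0 M"
    "\<And>i. 1 \<le> i \<Longrightarrow> i + M \<le> m \<Longrightarrow> off_parity z p i \<and> off_parity z p (i + M)"
  shows "unextendable G p"
proof (rule unextendable_if_separated[OF simple_graph_hypercube assms(1)])
  show "M \<le> card (edges G)" using assms(2) m by simp
  fix i assume i: "i + M \<le> card (edges G)"
  show "separated G p i (i + M)"
  proof (cases "i = 0")
    case False
    then obtain u v where uv: "p u = Some i" "p v = Some (i + M)" "length u = n" "length v = n"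
      "parity u \<noteq> parity z" "parity v \<noteq> parity z"
      using assms(4)[of i] i m z unfolding off_parity_def by auto
    hence "{u, v} \<notin> edges G" using adj_parity by (auto simp: edge_hypercube_iff)
    thus ?thesis using uv
      by (intro separated_if_not_adjacent[OF simple_graph_hypercube, of p u i v]) (auto simp: verts_hypercube)
  qed (use assms(3) in simp)
qed

section \<open>Play at star positions\<close>

lemma star_off_parity:
  assumes "p z = Some 0" "dom p \<subseteq> insert z N" "l \<in> ran p" "l \<noteq> 0"
  shows "off_parity z p l"
proof -
  obtain v where "p v = Some l" using assms(3) by (auto simp: ran_def)
  moreover from this have "adj z v" using assms by auto
  ultimately show ?thesis unfolding off_parity_def using adj_length adj_parity by blast
qed

lemma distinct_edge_labels_star_position:
  assumes "p z = Some 0" "dom p \<subseteq> insert z N" "inj_on p (dom p)"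
  shows "distinct_edge_labels {e \<in> edges G. e \<subseteq> dom p} (\<lambda>v. the (p v))"
proof (rule distinct_edge_labels_star[OF assms(1,3)])
  fix u v assume "{u, v} \<in> edges G" "u \<in> dom p" "v \<in> dom p"
  moreover from this have "parity v \<noteq> parity u" using adj_parity by (auto simp: edge_hypercube_iff)
  ultimately show "z = u \<or> z = v" using assms(2) adj_parity by blast
qed

lemma finite_N: "finite N"
  by (rule finite_adj)

lemma no_labelled_neighbour:
  assumes "dom p \<subseteq> insert z N" "length s = n" "parity s \<noteq> parity z" "s \<notin> N" "v \<in> dom p"
  shows "{s, v} \<notin> edges G"
proof
  assume "{s, v} \<in> edges G"
  hence "adj s v" by (simp add: edge_hypercube_iff)
  hence "v \<noteq> z" "parity v = parity z" using assms(3,4) adj_parity adj_commute by blast+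
  thus False using assms(1,5) adj_parity by blast
qed

text \<open>Bob's turn after Alice's forced answer; the next target is the edge label
  \<open>m - Suc k\<close>. Bob either makes it impossible or enlarges the star. The induction
  hypothesis is a premise because the induction runs over Alice's turns.\<close>

lemma star_Bob_wins:
  assumes star: "q z = Some 0" "dom q \<subseteq> insert z N" "inj_on q (dom q)"
      "{1..k} \<subseteq> ran q" "{m - Suc k<..m} \<subseteq> ran q"
      "\<And>l. l \<in> ran q \<Longrightarrow> l \<le> k \<or> m - Suc k < l \<or> l \<le> m div 2"
    and k: "2 * k \<le> n"
    and IH: "\<And>p. star_position (Suc k) p \<Longrightarrow> 2 * Suc k \<le> n \<Longrightarrow> bob_wins G Alice p"
  shows "bob_wins G Bob q"
proof -
  let ?M = "m - Suc k"
  have M: "1 \<le> ?M" "?M \<le> m" using k m_bound by auto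
  have Mq: "?M \<notin> ran q" using star(6)[of ?M] k m_bound by force
  have off: "off_parity z q l" if "l \<in> ran q" "l \<noteq> 0" for l
    using star_off_parity star(1,2) that by blast
  have dist: "distinct_edge_labels {e \<in> edges G. e \<subseteq> dom q} (\<lambda>v. the (q v))"
    using distinct_edge_labels_star_position star(1-3) by blast
  \<comment> \<open>The vertex \<open>s\<close> is in the class of the neighbours of
    \<open>z\<close> but is none of them, so it has no labelled neighbour and every free label is
    legal there.\<close>
  obtain s where s: "length s = n" "parity s \<noteq> parity z" "s \<notin> N"
    using ex_opposite_outside[OF finite_N] card_N n by auto
  have sq: "s \<notin> dom q" using s star(2) by blast
  have legal_s: "legal_move G q (s, l)" if "l \<le> m" "l \<notin> ran q" for l
    using legal_move_isolated[OF simple_graph_hypercube dist, of s l] s sq that m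
      no_labelled_neighbour[OF star(2) s]
    by (simp add: verts_hypercube)
  have offi: "off_parity z q i" "off_parity z q (i + ?M)" if "1 \<le> i" "i + ?M \<le> m" "i \<noteq> Suc k" for i
  proof -
    have "i \<in> {1..k}" "i + ?M \<in> {m - Suc k<..m}" using that M by auto
    hence "i \<in> ran q" "i + ?M \<in> ran q" using star(4,5) by blast+
    thus "off_parity z q i" "off_parity z q (i + ?M)" using off that by simp_all
  qed
  have offm: "off_parity z q (Suc k + ?M)"
  proof -
    have "Suc k + ?M \<in> {m - Suc k<..m}" using M by auto
    thus ?thesis using star(5) off M by (metis add_is_0 nat.distinct(1) subsetD)
  qed
  show ?thesis
  proof (cases "Suc k \<in> ran q")
    case True
    \<comment> \<open>\<open>Suc k\<close> is already present, for instance as Alice's opening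
      label. Only the pair of 0 and \<open>?M\<close> is still open, and \<open>?M\<close> on
      \<open>s\<close> closes it.\<close>
    let ?r = "make_move q (s, ?M)"
    have sub: "?r v = Some l" if "q v = Some l" for v l using that sq by (auto simp: make_move_def)
    have "separated G ?r 0 ?M"
      using s star(1) z sq
      by (intro separated_if_not_adjacent[OF simple_graph_hypercube, of _ z _ s])
        (auto simp: make_move_def verts_hypercube edge_hypercube_iff)
    moreover have "off_parity z ?r i \<and> off_parity z ?r (i + ?M)" if "1 \<le> i" "i + ?M \<le> m" for i
      using offi[OF that] offm off[OF True] by (cases "i = Suc k") (auto intro: off_parity_mono[OF _ sub])
    ultimately have "unextendable G ?r" by (rule unextendable_if_off_parity[OF M])
    thus ?thesis using legal_s[OF M(2) Mq] bob_moves bob_wins.unextendable by blast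
  next
    case k_new: False
    have km: "Suc k \<le> m" using k m_bound by simp
    show ?thesis
    proof (cases "N \<subseteq> dom q")
      case True
      \<comment> \<open>All neighbours of \<open>z\<close> are labelled, so \<open>?M\<close> can no
        longer come next to 0; \<open>Suc k\<close> on \<open>s\<close> completes the labels in the
        opposite class.\<close>
      let ?r = "make_move q (s, Suc k)"
      have sub: "?r v = Some l" if "q v = Some l" for v l using that sq by (auto simp: make_move_def)
      have r_other: "?r v = q v" if "v \<in> N" for v using that s by (auto simp: make_move_def)
      have "separated G ?r 0 ?M"
      proof (rule separated_if_neighbours_labelled[OF simple_graph_hypercube, of _ z])
        show "?r z = Some 0" using sub star(1) by blast
        show "z \<in> verts G" using z by (simp add: verts_hypercube)
        fix v assume "{z, v} \<in> edges G"
        hence v: "v \<in> N" by (simp add: edge_hypercube_iff)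
        hence "v \<in> dom q" "q v \<noteq> Some ?M" using True Mq by (auto simp: ran_def)
        thus "v \<in> dom ?r \<and> ?r v \<noteq> Some ?M" using r_other[OF v] by auto
      qed
      moreover have "off_parity z ?r (Suc k)"
        unfolding off_parity_def using s z by (intro exI[of _ s]) (simp add: make_move_def)
      hence "off_parity z ?r i \<and> off_parity z ?r (i + ?M)" if "1 \<le> i" "i + ?M \<le> m" for i
        using offi[OF that] offm by (cases "i = Suc k") (auto intro: off_parity_mono[OF _ sub])
      ultimately have "unextendable G ?r" by (rule unextendable_if_off_parity[OF M])
      thus ?thesis using legal_s[OF km k_new] bob_moves bob_wins.unextendable by blast
    next
      case False
      then obtain r where r: "r \<in> N" "r \<notin> dom q" by blast
      let ?r = "q(r \<mapsto> Suc k)"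
      have rz: "r \<noteq> z" using r not_adj_refl by blast
      have d: "?r z = Some 0" "dom ?r \<subseteq> insert z N" "inj_on ?r (dom ?r)"
      proof -
        show "?r z = Some 0" using star(1) rz by simp
        show "dom ?r \<subseteq> insert z N" using star(2) r(1) by simp
        show "inj_on ?r (dom ?r)" by (rule inj_on_map_upd[OF star(3) k_new])
      qed
      have ran: "ran ?r = insert (Suc k) (ran q)" using r(2) by (simp add: domIff ran_map_upd)
      have "legal_move G q (r, Suc k)"
        using r adj_length[of z r] z km k_new m distinct_edge_labels_star_position[OF d]
        by (simp add: legal_move_def Let_def make_move_def verts_hypercube)
      moreover have sp: "star_position (Suc k) ?r"
        unfolding star_position_def ran
      proof (intro conjI d)
        show "{1..Suc k} \<subseteq> insert (Suc k) (ran q)" using star(4) by (auto simp: le_Suc_eq)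
        show "\<forall>l\<in>insert (Suc k) (ran q). l \<le> Suc k \<or> m - Suc k < l \<or> l \<le> m div 2"
          using star(6) by force
      qed (use star(5) in blast)
      \<comment> \<open>The \<open>2 * Suc k\<close> small and large labels of the star sit on
        distinct neighbours of \<open>z\<close>, of which there are only \<open>n\<close>.\<close>
      moreover have "2 * Suc k \<le> n"
      proof -
        have "{1..Suc k} \<union> {m - Suc k<..m} \<subseteq> (\<lambda>v. the (?r v)) ` N"
        proof
          fix l assume l: "l \<in> {1..Suc k} \<union> {m - Suc k<..m}"
          hence "l \<in> ran ?r" using sp unfolding star_position_def by blast
          then obtain v where v: "?r v = Some l" by (auto simp: ran_def)
          hence "v \<noteq> z" using l d(1) by auto
          hence "v \<in> N" using v d(2) by blast
          thus "l \<in> (\<lambda>v. the (?r v)) ` N" using v by (intro image_eqI[of _ _ v]) auto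
        qed
        hence "card ({1..Suc k} \<union> {m - Suc k<..m}) \<le> card ((\<lambda>v. the (?r v)) ` N)"
          using finite_N by (intro card_mono) auto
        also have "\<dots> \<le> n" using card_image_le[OF finite_N] card_N by metis
        also have "card ({1..Suc k} \<union> {m - Suc k<..m}) = Suc k + Suc k"
          using k m_bound by (subst card_Un_disjoint) auto
        finally show ?thesis by simp
      qed
      ultimately show ?thesis using IH bob_moves by (metis fst_conv make_move_def snd_conv)
    qed
  qed
qed

text \<open>The edge label \<open>m - k\<close> hinges on the pair of 0 and \<open>m - k\<close>.
  Unless Alice has blocked it herself, Bob puts \<open>m - k\<close> on a vertex not adjacent to
  \<open>z\<close> and without labelled neighbours, or fills the last free neighbour of
  \<open>z\<close> with another label.\<close>

lemma star_position_deviation: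
  assumes star: "star_position k p" and k: "2 * k \<le> n"
    and legal: "legal_move G p (c, a)" and dev: "\<not> (adj z c \<and> a = m - k)"
  shows "bob_wins G Bob (p(c \<mapsto> a))"
proof -
  let ?q = "p(c \<mapsto> a)" and ?M = "m - k"
  have p: "p z = Some 0" "dom p \<subseteq> insert z N" "inj_on p (dom p)" "{1..k} \<subseteq> ran p"
      "{m - k<..m} \<subseteq> ran p" "\<And>l. l \<in> ran p \<Longrightarrow> l \<le> k \<or> m - k < l \<or> l \<le> m div 2"
    using star unfolding star_position_def by auto
  have c: "length c = n" "c \<notin> dom p" "a \<le> m" "a \<notin> ran p"
    and dist: "distinct_edge_labels {e \<in> edges G. e \<subseteq> dom ?q} (\<lambda>v. the (?q v))"
    using legal m by (auto simp: legal_move_def make_move_def verts_hypercube Let_def)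
  have cz: "c \<noteq> z" using c(2) p(1) by auto
  have M: "1 \<le> ?M" "?M \<le> m" using k m_bound by auto
  have Mp: "?M \<notin> ran p" using p(6)[of ?M] k m_bound by force
  have qz: "?q z = Some 0" using p(1) cz by simp
  have zv: "z \<in> verts G" using z by (simp add: verts_hypercube)
  have ran_q: "ran ?q = insert a (ran p)" using c(2) by (simp add: domIff ran_map_upd)
  \<comment> \<open>For positive \<open>i\<close> both \<open>i\<close> and \<open>i + ?M\<close>
    already sit on neighbours of \<open>z\<close>.\<close>
  have kill: "unextendable G r"
    if r: "\<And>v l. ?q v = Some l \<Longrightarrow> r v = Some l" "separated G r 0 ?M" for r
  proof (rule unextendable_if_off_parity[OF M r(2)])
    fix i assume i: "1 \<le> i" "i + ?M \<le> m"
    have "i \<in> {1..k}" "i + ?M \<in> {m - k<..m}" using i M by auto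
    hence "i \<in> ran p" "i + ?M \<in> ran p" using p(4,5) by blast+
    hence "off_parity z p i" "off_parity z p (i + ?M)" using star_off_parity[OF p(1,2)] i by auto
    moreover have "r v = Some l" if "p v = Some l" for v l using r(1)[of v l] that c(2) by (cases "v = c") auto
    ultimately show "off_parity z r i \<and> off_parity z r (i + ?M)" using off_parity_mono by blast
  qed
  have kill_far: "bob_wins G Bob ?q"
    if s: "length s = n" "s \<notin> dom ?q" "\<not> adj z s" "\<And>v. v \<in> dom ?q \<Longrightarrow> \<not> adj s v"
      and aM: "a \<noteq> ?M" for s
  proof -
    let ?r = "make_move ?q (s, ?M)"
    have l: "legal_move G ?q (s, ?M)"
    proof (rule legal_move_isolated[OF simple_graph_hypercube dist])
      show "s \<in> verts G" "s \<notin> dom ?q" using s by (simp_all add: verts_hypercube)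
      show "?M \<le> card (edges G)" using m by simp
      show "?M \<notin> ran ?q" using ran_q Mp aM by simp
      show "{s, v} \<notin> edges G" if "v \<in> dom ?q" for v using s(4)[OF that] by (simp add: edge_hypercube_iff)
    qed
    have sub: "?r v = Some l" if "?q v = Some l" for v l
      using that s(2) by (auto simp: make_move_def)
    have "separated G ?r 0 ?M"
      using s z sub[OF qz] zv
      by (intro separated_if_not_adjacent[OF simple_graph_hypercube, of _ z _ s])
        (auto simp: make_move_def verts_hypercube edge_hypercube_iff)
    hence "unextendable G ?r" using kill[of ?r] sub by blast
    thus ?thesis using l bob_moves bob_wins.unextendable by blast
  qed
  show ?thesis
  proof (cases "a = ?M")
    case True
    hence "\<not> adj z c" using dev by simp
    hence "separated G ?q 0 ?M"
      using True qz c z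
      by (intro separated_if_not_adjacent[OF simple_graph_hypercube, of _ z _ c])
        (auto simp: verts_hypercube edge_hypercube_iff)
    thus ?thesis using kill[of ?q] bob_wins.unextendable by blast
  next
    case aM: False
    have full: "unextendable G r"
      if r: "\<And>v l. ?q v = Some l \<Longrightarrow> r v = Some l" "N \<subseteq> dom r" "?M \<notin> ran r" for r
    proof (rule kill[OF r(1)])
      show "separated G r 0 ?M"
      proof (rule separated_if_neighbours_labelled[OF simple_graph_hypercube, of _ z])
        show "r z = Some 0" "z \<in> verts G" using r(1)[OF qz] zv by simp_all
        fix v assume "{z, v} \<in> edges G"
        thus "v \<in> dom r \<and> r v \<noteq> Some ?M" using r(2,3) by (auto simp: edge_hypercube_iff ran_def)
      qed
    qed
    show ?thesis
    proof (cases "\<exists>s. length s = n \<and> parity s \<noteq> parity z \<and> \<not> adj z s \<and> s \<noteq> c \<and> \<not> adj c s")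
      case True
      then obtain s where s: "length s = n" "parity s \<noteq> parity z" "\<not> adj z s" "s \<noteq> c" "\<not> adj c s"
        by blast
      have "s \<notin> dom ?q" using s p(2) by auto
      moreover have "\<not> adj s v" if "v \<in> dom ?q" for v
      proof (cases "v = c")
        case True
        thus ?thesis using s(5) adj_commute by blast
      next
        case False
        thus ?thesis using that no_labelled_neighbour[OF p(2) s(1,2), of v] s(1,3)
          by (auto simp: edge_hypercube_iff)
      qed
      ultimately show ?thesis using kill_far s(1,3) aM by blast
    next
      case False
      \<comment> \<open>By counting, this only happens for \<open>n = 4\<close> and \<open>c\<close> antipodal to \<open>z\<close>.\<close>
      have sub: "{v. length v = n \<and> parity v \<noteq> parity z} \<subseteq> N \<union> {c} \<union> {v. adj c v}"
        using False by blast
      have pc: "parity c = parity z"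
      \<comment> \<open>Otherwise no neighbour of \<open>c\<close> is opposite to \<open>z\<close>,
        and at most \<open>n + 1\<close> vertices would cover the opposite class.\<close>
      proof (rule ccontr)
        assume "parity c \<noteq> parity z"
        hence "{v. length v = n \<and> parity v \<noteq> parity z} \<subseteq> insert c N"
          using sub adj_parity by blast
        from card_mono[OF _ this] have "2 * n \<le> card (insert c N)"
          using finite_N card_opposite by simp
        also have "\<dots> \<le> Suc n" using card_N finite_N by (simp add: card_insert_if)
        finally show False using n by simp
      qed
      \<comment> \<open>Two neighbourhoods of \<open>n\<close> vertices each cover a class of at
        least \<open>2 * n\<close>, so they cannot overlap.\<close>
      have disj: "N \<inter> {v. adj c v} = {}"
      proof -
        have "{v. length v = n \<and> parity v \<noteq> parity z} \<subseteq> N \<union> {v. adj c v}" using sub pc by blast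
        from card_mono[OF _ this] have "2 * n \<le> card (N \<union> {v. adj c v})"
          using finite_N finite_adj card_opposite by simp
        moreover have "card (N \<union> {v. adj c v}) + card (N \<inter> {v. adj c v}) = 2 * n"
          using card_Un_Int[OF finite_N finite_adj[of c]] card_N card_adj[of c] c(1) by simp
        ultimately have "card (N \<inter> {v. adj c v}) = 0" by linarith
        thus ?thesis using finite_N by (metis card_0_eq finite_Int)
      qed
      have Mq: "?M \<notin> ran ?q" using ran_q Mp aM by simp
      consider "N \<subseteq> dom ?q" | r where "r \<in> N" "r \<notin> dom ?q" "N \<subseteq> insert r (dom ?q)"
        | r t where "r \<in> N" "t \<in> N" "r \<noteq> t" "r \<notin> dom ?q" "t \<notin> dom ?q"
        by blast
      thus ?thesis
      proof cases
        case 1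
        thus ?thesis using full[of ?q] Mq bob_wins.unextendable by blast
      next
        case 2
        \<comment> \<open>One neighbour of \<open>z\<close> is free. At most \<open>n + 2\<close>
          labels are used, so a free label other than \<open>?M\<close> remains for it.\<close>
        have "dom ?q \<subseteq> insert c (insert z N)" using p(2) by auto
        hence "card (dom ?q) \<le> card (insert c (insert z N))"
          using finite_N by (intro card_mono) auto
        also have "\<dots> \<le> n + 2"
          using card_N finite_N by (simp add: card_insert_if)
        finally have cd: "card (dom ?q) \<le> n + 2" .
        have fd: "finite (dom ?q)"
          using p(2) finite_N by (auto intro: finite_subset)
        have "ran ?q = (\<lambda>v. the (?q v)) ` dom ?q" by (force simp: ran_def)
        hence "card (ran ?q) \<le> n + 2" "finite (ran ?q)"
          using cd fd card_image_le[OF fd] by (metis le_trans, metis finite_imageI)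
        hence "card (insert ?M (ran ?q)) < card {..m}"
          using m_bound by (simp add: card_insert_if)
        then obtain b where b: "b \<le> m" "b \<notin> ran ?q" "b \<noteq> ?M"
          using card_mono[of "insert ?M (ran ?q)" "{..m}"] \<open>finite (ran ?q)\<close>
          by (metis atMost_iff finite_insert insertCI not_less subsetI)
        let ?r = "?q(r \<mapsto> b)"
        have "inj_on ?r (dom ?r)"
          using inj_on_map_upd[OF inj_on_map_upd[OF p(3) c(4)] b(2)] .
        moreover have rz: "?r z = Some 0" using qz 2(2) by auto
        \<comment> \<open>\<open>c\<close> is in the class of \<open>z\<close> and shares no
          neighbour with it, so again every labelled edge contains \<open>z\<close>.\<close>
        moreover have "z = u \<or> z = v" if e: "{u, v} \<in> edges G" "u \<in> dom ?r" "v \<in> dom ?r" for u v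
        proof -
          have a: "adj u v" "adj v u" using e(1) adj_commute by (auto simp: edge_hypercube_iff)
          have D: "w = z \<or> w = c \<or> w \<in> N" if "w \<in> dom ?r" for w
            using that p(2) 2(1) by (auto split: if_splits)
          show ?thesis using D[OF e(2)] D[OF e(3)] a adj_parity pc disj not_adj_refl by blast
        qed
        ultimately have "distinct_edge_labels {e \<in> edges G. e \<subseteq> dom ?r} (\<lambda>v. the (?r v))"
          using distinct_edge_labels_star[of ?r z G] by blast
        moreover have "length r = n" using 2(1) adj_length z by blast
        ultimately have l: "legal_move G ?q (r, b)"
          unfolding legal_move_def Let_def make_move_def fst_conv snd_conv
          using 2(2) b m by (auto simp: verts_hypercube)
        have "?M \<notin> ran ?r" using Mq b(3) 2(2) by (simp add: domIff ran_map_upd)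
        moreover have "N \<subseteq> dom ?r" using 2(3) by auto
        ultimately have "unextendable G ?r" using full[of ?r] 2(2) by (metis domI fun_upd_apply)
        hence "bob_wins G Alice ?r" by (rule bob_wins.unextendable)
        thus ?thesis using bob_moves[OF l] by (simp add: make_move_def)
      next
        case 3
        \<comment> \<open>The other common neighbour of \<open>r\<close> and \<open>t\<close>: its
          only neighbours in \<open>N\<close> are these two unlabelled vertices, and
          \<open>z\<close> and \<open>c\<close> are in its own class, so \<open>?M\<close> can be
          placed there.\<close>
        obtain s where s: "s \<noteq> z" "adj s r" "adj s t" "\<And>v. adj z v \<Longrightarrow> adj s v \<Longrightarrow> v = r \<or> v = t"
          using ex_common_neighbour[of z r t] 3 by auto
        have "length s = n" using s(2) 3(1) adj_length z by (metis mem_Collect_eq)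
        moreover have ps: "parity s = parity z" using s(2) 3(1) adj_parity by blast
        hence "\<not> adj z s" using adj_parity by blast
        moreover have "s \<noteq> c" using s(2) 3(1) disj by blast
        hence "s \<notin> dom ?q" using s(1) p(2) \<open>\<not> adj z s\<close> by auto
        moreover have "\<not> adj s v" if v: "v \<in> dom ?q" for v
        proof
          assume a: "adj s v"
          hence "v \<noteq> z" "v \<noteq> c" using adj_parity ps pc by blast+
          hence "adj z v" using v p(2) by auto
          thus False using s(4)[OF _ a] v 3(4,5) by blast
        qed
        ultimately show ?thesis using kill_far aM by blast
      qed
    qed
  qed
qed

text \<open>Each forced exchange raises \<open>k\<close> by one, and \<open>2 * k \<le> n\<close>
  keeps \<open>n - k\<close> a decreasing measure.\<close>

lemma star_position_wins:
  "star_position k p \<Longrightarrow> 2 * k \<le> n \<Longrightarrow> bob_wins G Alice p"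
proof (induction "n - k" arbitrary: k p rule: less_induct)
  case less
  note p = less.prems(1)[unfolded star_position_def]
  obtain s where s: "length s = n" "parity s \<noteq> parity z" "s \<notin> N"
    using ex_opposite_outside[OF finite_N] card_N n by auto
  hence "s \<notin> dom p" using p by blast
  show ?case
  proof (rule alice_moves)
    show "dom p \<noteq> verts G" using s(1) \<open>s \<notin> dom p\<close> by (auto simp: verts_hypercube)
    fix mv assume legal: "legal_move G p mv"
    obtain c a where mv: "mv = (c, a)" by (cases mv)
    have mm: "make_move p mv = p(c \<mapsto> a)" by (simp add: mv make_move_def)
    show "bob_wins G Bob (make_move p mv)"
    proof (cases "adj z c \<and> a = m - k")
      case False
      thus ?thesis
        using star_position_deviation[OF less.prems, of c a] legal unfolding mm by (simp add: mv)
    next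
      case True
      let ?q = "p(c \<mapsto> a)"
      have c: "c \<notin> dom p" "a \<notin> ran p" using legal by (auto simp: legal_move_def mv)
      have ran: "ran ?q = insert (m - k) (ran p)" using c(1) True by (simp add: domIff ran_map_upd)
      have "bob_wins G Bob ?q"
      proof (rule star_Bob_wins[of ?q k])
        show "?q z = Some 0" using p c(1) by auto
        show "dom ?q \<subseteq> insert z N" using p True by auto
        show "inj_on ?q (dom ?q)" by (rule inj_on_map_upd) (use p c(2) in blast)+
        show "{1..k} \<subseteq> ran ?q" using p ran by blast
        have "l \<in> ran ?q" if "l \<in> {m - Suc k<..m}" for l
        proof (cases "l = m - k")
          case False
          hence "l \<in> {m - k<..m}" using that by auto
          thus ?thesis using p ran by blast
        qed (simp add: ran)
        thus "{m - Suc k<..m} \<subseteq> ran ?q" by blast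
        show "l \<le> k \<or> m - Suc k < l \<or> l \<le> m div 2" if "l \<in> ran ?q" for l
          using that p m_bound less.prems(2) unfolding ran by auto
        show "2 * k \<le> n" by fact
        show "bob_wins G Alice p'" if "star_position (Suc k) p'" "2 * Suc k \<le> n" for p'
          using less.hyps[OF _ that] that(2) by simp
      qed
      thus ?thesis by (simp add: mm)
    qed
  qed
qed

end

text \<open>If \<open>x\<close> is 0, Alice's vertex is itself the centre and Bob blocks the largest
  edge label, whose only pair has smaller label 0. Otherwise Bob puts 0 on a neighbour, and Alice's
  vertex becomes a leaf of the star.\<close>

lemma hypercube_bob_wins_small_label:
  assumes n: "4 \<le> n" and v: "length v = n" and x: "x \<le> card (edges (hypercube n)) div 2"
  shows "bob_wins (hypercube n) Bob [v \<mapsto> x]"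
proof (cases "x = 0")
  case True
  let ?G = "hypercube n" and ?p = "[v \<mapsto> x]"
  interpret star n "card (edges ?G)" v using n v by unfold_locales auto
  let ?m = "card (edges ?G)"
  obtain s where s: "length s = n" "parity s \<noteq> parity v" "\<not> adj v s"
    using ex_opposite_outside[OF finite_N] card_N n by auto
  have sv: "s \<noteq> v" using s(2) by blast
  have "distinct_edge_labels {e \<in> edges ?G. e \<subseteq> dom ?p} (\<lambda>v. the (?p v))"
    using True by (intro distinct_edge_labels_star_position) auto
  hence l: "legal_move ?G ?p (s, ?m)"
    using s sv True m_bound adj_commute
    by (intro legal_move_isolated[OF simple_graph_hypercube])
      (auto simp: verts_hypercube edge_hypercube_iff)
  have "separated ?G (make_move ?p (s, ?m)) 0 ?m"
    using s sv v True
    by (intro separated_if_not_adjacent[OF simple_graph_hypercube, of _ v _ s])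
      (auto simp: make_move_def verts_hypercube edge_hypercube_iff)
  hence "unextendable ?G (make_move ?p (s, ?m))"
    using m_bound by (intro unextendable_if_off_parity[of ?m]) auto
  thus ?thesis using l bob_moves bob_wins.unextendable by blast
next
  case False
  let ?G = "hypercube n" and ?p = "[v \<mapsto> x]"
  have "{z. adj v z} \<noteq> {}" using card_adj[of v] n v by force
  then obtain z where vz: "adj v z" by blast
  hence zl: "length z = n" using adj_length v by simp
  interpret star n "card (edges ?G)" z using n zl by unfold_locales auto
  have zv: "z \<noteq> v" using vz not_adj_refl by blast
  let ?q = "?p(z \<mapsto> 0)"
  have q: "?q z = Some 0" "dom ?q \<subseteq> insert z {u. adj z u}" "inj_on ?q (dom ?q)"
    using vz adj_commute zv False by (auto simp: inj_on_def)
  have "legal_move ?G ?p (z, 0)"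
    using distinct_edge_labels_star_position[OF q] zv zl False
    by (simp add: legal_move_def make_move_def Let_def verts_hypercube)
  moreover have "star_position 0 ?q"
    unfolding star_position_def using q x zv by (simp add: ran_map_upd)
  hence "bob_wins ?G Alice ?q" by (rule star_position_wins) simp
  ultimately show ?thesis using bob_moves[of ?G ?p "(z, 0)"] by (simp add: make_move_def)
qed

lemma hypercube_bob_wins_large:
  assumes "4 \<le> n"
  shows "bob_wins (hypercube n) first Map.empty"
proof (cases first)
  case Bob
  let ?z = "replicate n False"
  interpret star n "card (edges (hypercube n))" ?z using assms by unfold_locales auto
  let ?q = "[?z \<mapsto> 0]"
  have q: "?q ?z = Some 0" "dom ?q \<subseteq> insert ?z {u. adj ?z u}" "inj_on ?q (dom ?q)" by auto
  have "legal_move G Map.empty (?z, 0)"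
    using distinct_edge_labels_star_position[OF q]
    by (simp add: legal_move_def make_move_def Let_def verts_hypercube)
  moreover have "star_position 0 ?q" unfolding star_position_def using q by simp
  hence "bob_wins G Alice ?q" by (rule star_position_wins) simp
  ultimately show ?thesis using bob_moves[of G Map.empty "(?z, 0)"] Bob by (simp add: make_move_def)
next
  case Alice
  thus ?thesis
    using bob_wins_Alice_first hypercube_bob_wins_small_label[OF assms] by simp
qed

section \<open>Dimensions two and three\<close>

type_synonym labelled = "(bool list \<times> nat) list"

fun edge_pairs :: "labelled \<Rightarrow> ((bool list \<times> nat) \<times> (bool list \<times> nat)) list" where
  "edge_pairs [] = []"
| "edge_pairs (q # ps) = map (Pair q) (filter (\<lambda>r. adj (fst q) (fst r)) ps) @ edge_pairs ps"

definition edge_label :: "(bool list \<times> nat) \<times> (bool list \<times> nat) \<Rightarrow> nat" where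
  "edge_label = (\<lambda>((_, k), (_, l)). if k \<le> l then l - k else k - l)"

definition edge_of :: "(bool list \<times> nat) \<times> (bool list \<times> nat) \<Rightarrow> bool list set" where
  "edge_of e = {fst (fst e), fst (snd e)}"

definition legal_check :: "nat \<Rightarrow> nat \<Rightarrow> labelled \<Rightarrow> bool list \<times> nat \<Rightarrow> bool" where
  "legal_check n m ps mv =
     (if length (fst mv) \<noteq> n then False
      else if m < snd mv then False
      else if fst mv \<in> set (map fst ps) then False
      else if snd mv \<in> set (map snd ps) then False
      else distinct (map edge_label (edge_pairs (mv # ps))))"

definition all_moves :: "nat \<Rightarrow> nat \<Rightarrow> (bool list \<times> nat) list" where
  "all_moves n m = List.product (List.n_lists n [False, True]) [0..<Suc m]"

definition find_label :: "labelled \<Rightarrow> nat \<Rightarrow> bool list option" where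
  "find_label ps l = map_of (map prod.swap ps) l"

definition saturated :: "labelled \<Rightarrow> bool list \<Rightarrow> bool" where
  "saturated ps v \<longleftrightarrow> list_all (\<lambda>w. w \<in> set (map fst ps)) (nbrs v)"

text \<open>A sufficient test built from the two criteria for \<open>separated\<close>; it answers
  \<open>False\<close> when neither label has been placed.\<close>

definition separated_check :: "labelled \<Rightarrow> nat \<Rightarrow> nat \<Rightarrow> bool" where
  "separated_check ps a b =
     (case find_label ps a of
        None \<Rightarrow> (case find_label ps b of None \<Rightarrow> False | Some v \<Rightarrow> saturated ps v)
      | Some u \<Rightarrow> (case find_label ps b of None \<Rightarrow> saturated ps u | Some v \<Rightarrow> \<not> adj u v))"

text \<open>Only the three largest edge labels are tried; they come from one, two and three pairs of
  labels.\<close>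

definition dead_check :: "nat \<Rightarrow> labelled \<Rightarrow> bool" where
  "dead_check m ps =
     list_ex (\<lambda>M. list_all (\<lambda>i. separated_check ps i (i + M)) [0..<Suc (m - M)]) [m, m - 1, m - 2]"

text \<open>Conditionals instead of quantifiers over lists keep symbolic evaluation lazy.\<close>

fun first_success :: "('a \<Rightarrow> bool) \<Rightarrow> 'a list \<Rightarrow> bool" where
  "first_success P [] = False"
| "first_success P (x # xs) = (if P x then True else first_success P xs)"

fun no_failure :: "('a \<Rightarrow> bool) \<Rightarrow> 'a list \<Rightarrow> bool" where
  "no_failure P [] = True"
| "no_failure P (x # xs) = (if P x then no_failure P xs else False)"

text \<open>\<open>B\<close> stands for the check at Bob's next turn, so that the recursion runs
  through \<open>bob_check\<close> alone.\<close>

definition alice_check ::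
    "nat \<Rightarrow> nat \<Rightarrow> (labelled \<Rightarrow> bool) \<Rightarrow> labelled \<Rightarrow> bool" where
  "alice_check n m B ps =
     (if dead_check m ps then True
      else if length ps < 2 ^ n
      then no_failure (\<lambda>mv. if legal_check n m ps mv then B (mv # ps) else True) (all_moves n m)
      else False)"

text \<open>The lists contain the candidates for Bob's successive moves.\<close>

fun bob_check :: "nat \<Rightarrow> nat \<Rightarrow> (bool list \<times> nat) list list \<Rightarrow> labelled \<Rightarrow> bool" where
  "bob_check n m [] ps = dead_check m ps"
| "bob_check n m (c # cs) ps =
     (if dead_check m ps then True
      else if first_success (\<lambda>mv. if legal_check n m ps mv
        then alice_check n m (bob_check n m cs) (mv # ps) else False) c then True
      else if length ps < 2 ^ n
      then no_failure (\<lambda>mv. \<not> legal_check n m ps mv) (all_moves n m)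
      else False)"

lemma first_success_iff: "first_success P xs \<longleftrightarrow> (\<exists>x\<in>set xs. P x)"
  by (induction xs) auto

lemma no_failure_iff: "no_failure P xs \<longleftrightarrow> (\<forall>x\<in>set xs. P x)"
  by (induction xs) auto

section \<open>Soundness of the search\<close>

definition labelling :: "nat \<Rightarrow> labelled \<Rightarrow> bool" where
  "labelling n ps \<longleftrightarrow> distinct (map fst ps) \<and> (\<forall>q\<in>set ps. length (fst q) = n)"

lemma set_edge_pairs:
  "e \<in> set (edge_pairs ps) \<Longrightarrow> fst e \<in> set ps \<and> snd e \<in> set ps \<and> adj (fst (fst e)) (fst (snd e))"
  by (induction ps) auto

lemma edge_pairs_complete:
  assumes "q \<in> set ps" "r \<in> set ps" "adj (fst q) (fst r)"
  shows "(q, r) \<in> set (edge_pairs ps) \<or> (r, q) \<in> set (edge_pairs ps)"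
  using assms by (induction ps) (auto simp: adj_commute not_adj_refl)

text \<open>Each edge is listed once, so a repeated value among the listed edge labels stems from
  two different edges.\<close>

lemma distinct_edge_of:
  "distinct (map fst ps) \<Longrightarrow> distinct (map edge_of (edge_pairs ps))"
proof (induction ps)
  case (Cons q ps)
  let ?F = "filter (\<lambda>r. adj (fst q) (fst r)) ps"
  have d: "distinct (map fst ps)" "fst q \<notin> fst ` set ps" using Cons.prems by auto
  have ne: "fst r \<noteq> fst q" if "r \<in> set ps" for r using d(2) that by (metis imageI)
  have inj: "inj_on (edge_of \<circ> Pair q) (set ?F)"
  proof (rule inj_onI)
    fix r r' assume r: "r \<in> set ?F" "r' \<in> set ?F" "(edge_of \<circ> Pair q) r = (edge_of \<circ> Pair q) r'"
    have "fst r \<noteq> fst q" "fst r' \<noteq> fst q" using ne r(1,2) by simp_all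
    hence "fst r = fst r'" using r(3) by (simp add: edge_of_def doubleton_eq_iff)
    moreover have "inj_on fst (set ps)" using d(1) by (simp add: distinct_map)
    ultimately show "r = r'" using r(1,2) by (simp add: inj_on_def)
  qed
  have "distinct ps" using d(1) by (simp add: distinct_map)
  hence "distinct (map (edge_of \<circ> Pair q) ?F)" using inj by (simp only: distinct_map distinct_filter)
  hence "distinct (map edge_of (map (Pair q) ?F))" by (simp only: map_map)
  moreover have "edge_of (q, r) \<noteq> edge_of e" if "e \<in> set (edge_pairs ps)" for r e
    using set_edge_pairs[OF that] ne[of "fst e"] ne[of "snd e"]
    by (simp add: edge_of_def doubleton_eq_iff)
  hence "set (map edge_of (map (Pair q) ?F)) \<inter> set (map edge_of (edge_pairs ps)) = {}" by auto
  ultimately show ?case using Cons.IH d(1) by (simp only: edge_pairs.simps map_append distinct_append)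
qed simp

lemma map_of_labelling: "labelling n ps \<Longrightarrow> q \<in> set ps \<Longrightarrow> map_of ps (fst q) = Some (snd q)"
  by (simp add: labelling_def)

text \<open>\<open>edge_of\<close> matches the listed pairs with the labelled edges one to one and
  respects edge labels, so injectivity passes between list and set.\<close>

lemma distinct_edge_labels_check:
  assumes "labelling n ps"
  shows "distinct_edge_labels {e \<in> edges (hypercube n). e \<subseteq> dom (map_of ps)} (\<lambda>v. the (map_of ps v))
    \<longleftrightarrow> distinct (map edge_label (edge_pairs ps))"
proof -
  let ?E = "{e \<in> edges (hypercube n). e \<subseteq> dom (map_of ps)}" and ?f = "\<lambda>v. the (map_of ps v)"
  have inj: "distinct (edge_pairs ps)" "inj_on edge_of (set (edge_pairs ps))"
    using distinct_edge_of assms by (simp_all add: labelling_def distinct_map)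
  have ep: "\<exists>u v. edge_of e = {u, v} \<and> {u, v} \<in> ?E \<and>
      int (edge_label e) = \<bar>int (?f u) - int (?f v)\<bar>" if "e \<in> set (edge_pairs ps)" for e
  proof -
    obtain u k v l where e: "e = ((u, k), (v, l))" by (metis surj_pair)
    have s: "(u, k) \<in> set ps" "(v, l) \<in> set ps" "adj u v" using set_edge_pairs[OF that] e by auto
    have "map_of ps u = Some k" "map_of ps v = Some l" "length u = n"
      using map_of_labelling[OF assms s(1)] map_of_labelling[OF assms s(2)] s(1) assms
      by (auto simp: labelling_def)
    thus ?thesis
      using s(3) e by (intro exI[of _ u] exI[of _ v]) (auto simp: edge_of_def edge_label_def edge_hypercube_iff)
  qed
  have pe: "\<exists>e\<in>set (edge_pairs ps). edge_of e = {u, v} \<and>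
      int (edge_label e) = \<bar>int (?f u) - int (?f v)\<bar>" if uv: "{u, v} \<in> ?E" for u v
  proof -
    obtain k l where kl: "map_of ps u = Some k" "map_of ps v = Some l" using uv by auto
    hence "(u, k) \<in> set ps" "(v, l) \<in> set ps" by (auto dest: map_of_SomeD)
    moreover have "adj u v" using uv by (simp add: edge_hypercube_iff)
    ultimately have "((u, k), (v, l)) \<in> set (edge_pairs ps) \<or> ((v, l), (u, k)) \<in> set (edge_pairs ps)"
      using edge_pairs_complete[of "(u, k)" ps "(v, l)"] by simp
    thus ?thesis
    proof
      assume "((u, k), (v, l)) \<in> set (edge_pairs ps)"
      thus ?thesis using kl by (intro bexI[of _ "((u, k), (v, l))"]) (auto simp: edge_of_def edge_label_def)
    next
      assume "((v, l), (u, k)) \<in> set (edge_pairs ps)"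
      thus ?thesis using kl by (intro bexI[of _ "((v, l), (u, k))"]) (auto simp: edge_of_def edge_label_def)
    qed
  qed
  show ?thesis
  proof
    assume D: "distinct_edge_labels ?E ?f"
    have "inj_on edge_label (set (edge_pairs ps))"
    proof (rule inj_onI)
      fix d e assume de: "d \<in> set (edge_pairs ps)" "e \<in> set (edge_pairs ps)" "edge_label d = edge_label e"
      obtain u v where d: "edge_of d = {u, v}" "{u, v} \<in> ?E"
        "int (edge_label d) = \<bar>int (?f u) - int (?f v)\<bar>" using ep[OF de(1)] by blast
      obtain x y where e: "edge_of e = {x, y}" "{x, y} \<in> ?E"
        "int (edge_label e) = \<bar>int (?f x) - int (?f y)\<bar>" using ep[OF de(2)] by blast
      have "\<bar>int (?f u) - int (?f v)\<bar> = \<bar>int (?f x) - int (?f y)\<bar>" using d(3) e(3) de(3) by simp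
      hence "{u, v} = {x, y}" by (rule D[unfolded distinct_edge_labels_def, rule_format, OF d(2) e(2)])
      thus "d = e" using inj_onD[OF inj(2)] d(1) e(1) de(1,2) by metis
    qed
    thus "distinct (map edge_label (edge_pairs ps))" using inj(1) by (simp add: distinct_map)
  next
    assume "distinct (map edge_label (edge_pairs ps))"
    hence I: "inj_on edge_label (set (edge_pairs ps))" by (simp add: distinct_map)
    show "distinct_edge_labels ?E ?f"
      unfolding distinct_edge_labels_def
    proof (intro allI impI)
      fix u v x y
      assume e: "{u, v} \<in> ?E" "{x, y} \<in> ?E" "\<bar>int (?f u) - int (?f v)\<bar> = \<bar>int (?f x) - int (?f y)\<bar>"
      obtain d where d: "d \<in> set (edge_pairs ps)" "edge_of d = {u, v}"
        "int (edge_label d) = \<bar>int (?f u) - int (?f v)\<bar>" using pe[OF e(1)] by blast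
      obtain d' where d': "d' \<in> set (edge_pairs ps)" "edge_of d' = {x, y}"
        "int (edge_label d') = \<bar>int (?f x) - int (?f y)\<bar>" using pe[OF e(2)] by blast
      have "edge_label d = edge_label d'" using d(3) d'(3) e(3) by linarith
      hence "d = d'" using inj_onD[OF I] d(1) d'(1) by blast
      thus "{u, v} = {x, y}" using d(2) d'(2) by simp
    qed
  qed
qed

lemma make_move_map_of: "make_move (map_of ps) mv = map_of (mv # ps)"
  by (cases mv) (simp add: make_move_def)

text \<open>Both directions matter: Bob's tested moves must be legal, and no legal move of Alice may
  be overlooked.\<close>

lemma legal_check_iff:
  assumes "labelling n ps"
  shows "legal_check n (card (edges (hypercube n))) ps mv \<longleftrightarrow> legal_move (hypercube n) (map_of ps) mv"
proof (cases "length (fst mv) = n \<and> fst mv \<notin> set (map fst ps)")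
  case True
  hence "labelling n (mv # ps)" using assms by (simp add: labelling_def)
  note D = distinct_edge_labels_check[OF this]
  have "ran (map_of ps) = snd ` set ps" using assms by (simp add: labelling_def ran_distinct)
  thus ?thesis
    using True unfolding legal_check_def legal_move_def Let_def make_move_map_of D
    by (auto simp only: verts_hypercube dom_map_of_conv_image_fst set_map split: if_splits) simp_all
next
  case False
  thus ?thesis
    by (auto simp: legal_check_def legal_move_def verts_hypercube dom_map_of_conv_image_fst)
qed

lemma labelling_legal:
  "labelling n ps \<Longrightarrow> legal_check n m ps mv \<Longrightarrow> labelling n (mv # ps)"
  by (auto simp: labelling_def legal_check_def split: if_splits)

lemma all_moves_complete:
  "legal_check n m ps mv \<Longrightarrow> mv \<in> set (all_moves n m)"
  by (cases mv) (auto simp: legal_check_def all_moves_def set_n_lists split: if_splits)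

lemma saturated_separated:
  assumes "labelling n ps" "(u, a) \<in> set ps" "saturated ps u" "b \<notin> snd ` set ps"
  shows "separated (hypercube n) (map_of ps) a b"
proof (rule separated_if_neighbours_labelled[OF simple_graph_hypercube, of _ u])
  show "map_of ps u = Some a" using map_of_labelling[OF assms(1,2)] by simp
  show "u \<in> verts (hypercube n)" using assms(1,2) by (auto simp: labelling_def verts_hypercube)
  fix v assume "{u, v} \<in> edges (hypercube n)"
  hence "v \<in> set (nbrs u)" by (simp add: edge_hypercube_iff set_nbrs)
  hence "v \<in> fst ` set ps" using assms(3) by (auto simp: saturated_def list_all_iff)
  moreover have "map_of ps v \<noteq> Some b" using assms(4) by (force dest: map_of_SomeD)
  ultimately show "v \<in> dom (map_of ps) \<and> map_of ps v \<noteq> Some b" by (simp add: dom_map_of_conv_image_fst)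
qed

lemma find_label_Some: "find_label ps l = Some v \<Longrightarrow> (v, l) \<in> set ps"
  by (auto simp: find_label_def dest: map_of_SomeD)

lemma find_label_None: "find_label ps l = None \<Longrightarrow> l \<notin> snd ` set ps"
  by (auto simp: find_label_def map_of_eq_None_iff image_iff)

lemma separated_check_sound:
  assumes "labelling n ps" "separated_check ps a b"
  shows "separated (hypercube n) (map_of ps) a b"
proof (cases "find_label ps a")
  case None
  then obtain v where v: "find_label ps b = Some v" "saturated ps v"
    using assms(2) by (auto simp: separated_check_def split: option.splits)
  show ?thesis
    using saturated_separated[OF assms(1) find_label_Some[OF v(1)] v(2) find_label_None[OF None]]
    by (rule separated_commute)
next
  case u: (Some u)
  show ?thesis
  proof (cases "find_label ps b")
    case None
    thus ?thesis using saturated_separated[OF assms(1) find_label_Some[OF u]] assms(2) u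
        find_label_None by (simp add: separated_check_def)
  next
    case (Some v)
    have "(u, a) \<in> set ps" "(v, b) \<in> set ps" using u Some find_label_Some by blast+
    moreover from this have "map_of ps u = Some a" "map_of ps v = Some b"
      using map_of_labelling[OF assms(1)] by force+
    moreover have "\<not> adj u v" using assms(2) u Some by (simp add: separated_check_def)
    ultimately show ?thesis using assms(1)
      by (intro separated_if_not_adjacent[OF simple_graph_hypercube, of _ u _ v])
        (auto simp: verts_hypercube labelling_def edge_hypercube_iff)
  qed
qed

text \<open>The bound 3 makes the smallest edge label tried positive.\<close>

lemma dead_check_sound:
  assumes "labelling n ps" "dead_check (card (edges (hypercube n))) ps" "3 \<le> card (edges (hypercube n))"
  shows "unextendable (hypercube n) (map_of ps)"
proof -
  let ?m = "card (edges (hypercube n))"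
  obtain M where "M \<in> set [?m, ?m - 1, ?m - 2]"
    and sep: "\<forall>i\<in>set [0..<Suc (?m - M)]. separated_check ps i (i + M)"
    using assms(2) unfolding dead_check_def list_ex_iff list_all_iff by blast
  hence M: "M \<in> {?m, ?m - 1, ?m - 2}" by simp
  show ?thesis
  proof (rule unextendable_if_separated[OF simple_graph_hypercube, of M])
    show "1 \<le> M" "M \<le> ?m" using M assms(3) by auto
    show "separated (hypercube n) (map_of ps) i (i + M)" if "i + M \<le> ?m" for i
    proof (rule separated_check_sound[OF assms(1)])
      show "separated_check ps i (i + M)" using that by (intro sep[rule_format]) auto
    qed
  qed
qed

lemma dom_labelling_neq:
  assumes "labelling n ps" "length ps < 2 ^ n"
  shows "dom (map_of ps) \<noteq> verts (hypercube n)"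
proof
  assume "dom (map_of ps) = verts (hypercube n)"
  hence "card (fst ` set ps) = 2 ^ n" by (simp add: dom_map_of_conv_image_fst verts_hypercube card_lists)
  moreover have "card (fst ` set ps) \<le> length ps"
    by (metis card_length length_map set_map)
  ultimately show False using assms(2) by simp
qed

text \<open>Induction on the candidate lists, one for each turn of Bob. Few candidates are enough
  for Bob, who needs one good reply, while Alice's moves are enumerated completely.\<close>

lemma bob_check_sound:
  assumes "m = card (edges (hypercube n))" "3 \<le> m" "labelling n ps" "bob_check n m cs ps"
  shows "bob_wins (hypercube n) Bob (map_of ps)"
proof -
  have dead: "bob_wins (hypercube n) P (map_of qs)" if "labelling n qs" "dead_check m qs" for qs P
    using that assms(1,2) by (intro bob_wins.unextendable dead_check_sound) auto
  show ?thesis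
    using assms(3,4)
  proof (induction cs arbitrary: ps)
    case Nil
    thus ?case using dead by simp
  next
    case (Cons c cs)
    let ?G = "hypercube n"
    note legal = legal_check_iff[of n, folded assms(1)]
    have alice: "bob_wins ?G Alice (map_of qs)"
      if qs: "labelling n qs" "alice_check n m (bob_check n m cs) qs" for qs
    proof (cases "dead_check m qs")
      case True
      thus ?thesis using dead qs(1) by blast
    next
      case False
      hence len: "length qs < 2 ^ n"
        and next_: "\<And>mv. legal_check n m qs mv \<Longrightarrow> bob_check n m cs (mv # qs)"
        using qs(2) all_moves_complete[of n m qs]
        by (auto simp: alice_check_def no_failure_iff split: if_splits)
      show ?thesis
      proof (rule alice_moves[OF dom_labelling_neq[OF qs(1) len]])
        fix mv assume "legal_move ?G (map_of qs) mv"
        hence "legal_check n m qs mv" using legal[OF qs(1)] by simp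
        thus "bob_wins ?G Bob (make_move (map_of qs) mv)"
          unfolding make_move_map_of using Cons.IH next_ labelling_legal[OF qs(1)] by blast
      qed
    qed
    have "dead_check m ps \<or>
        (\<exists>mv. legal_check n m ps mv \<and> alice_check n m (bob_check n m cs) (mv # ps)) \<or>
        length ps < 2 ^ n \<and> (\<forall>mv\<in>set (all_moves n m). \<not> legal_check n m ps mv)"
      using Cons.prems(2) by (auto simp: first_success_iff no_failure_iff split: if_splits)
    moreover have "\<nexists>mv. legal_check n m ps mv" if "\<forall>mv\<in>set (all_moves n m). \<not> legal_check n m ps mv"
      using that all_moves_complete[of n m ps] by blast
    ultimately consider "dead_check m ps"
      | mv where "legal_check n m ps mv" "alice_check n m (bob_check n m cs) (mv # ps)"
      | "length ps < 2 ^ n" "\<nexists>mv. legal_check n m ps mv"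
      by blast
    thus ?case
    proof cases
      case 1
      thus ?thesis using dead Cons.prems(1) by blast
    next
      case 2
      have "legal_move ?G (map_of ps) mv" using 2(1) legal[OF Cons.prems(1)] by simp
      moreover have "bob_wins ?G Alice (make_move (map_of ps) mv)"
        unfolding make_move_map_of using alice labelling_legal[OF Cons.prems(1) 2(1)] 2(2) by blast
      ultimately show ?thesis by (rule bob_moves)
    next
      case 3
      show ?thesis
        using 3(2) by (intro stuck dom_labelling_neq[OF Cons.prems(1) 3(1)]) (simp add: legal[OF Cons.prems(1)])
    qed
  qed
qed

section \<open>Evaluation for the square and the cube\<close>

definition square_moves :: "(bool list \<times> nat) list list" where
  "square_moves = replicate 3 (all_moves 2 4)"

lemma square_check:
  "bob_check 2 4 square_moves []"
  "no_failure (\<lambda>x. bob_check 2 4 square_moves [(replicate 2 False, x)]) [0..<Suc (4 div 2)]"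
  by code_simp+

text \<open>Bob opens with 0. His second move is 12 on a vertex not adjacent to it, which blocks the
  edge label 12, or else 1 on a neighbour, as in the general argument.\<close>

definition cube_first_moves :: "(bool list \<times> nat) list list" where
  "cube_first_moves =
     [[([False, False, False], 0)],
      [([True, True, True], 12), ([True, True, False], 12), ([True, False, True], 12),
       ([True, False, False], 1), ([False, True, False], 1)],
      List.product (List.n_lists 3 [False, True]) [11, 2, 3]]"

text \<open>Alice has labelled the zero vertex. Bob answers with 0 on a neighbour; if her label is
  0, this is illegal and 12 at distance two blocks the edge label 12. The second list first tries 12
  away from Bob's 0, then 1 next to it, then special replies.\<close>

definition cube_second_moves :: "(bool list \<times> nat) list list" where
  "cube_second_moves =
     [[([True, False, False], 0), ([True, True, False], 12)],
      [([False, True, True], 12), ([True, True, True], 12), ([False, True, False], 12),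
       ([True, False, True], 1), ([True, True, False], 1), ([False, True, False], 11),
       ([True, False, True], 12), ([True, False, True], 5)],
      all_moves 3 12]"

lemma cube_check:
  "bob_check 3 12 cube_first_moves []"
  "no_failure (\<lambda>x. bob_check 3 12 cube_second_moves [(replicate 3 False, x)]) [0..<Suc (12 div 2)]"
  by code_simp+

lemma hypercube_bob_wins_if_check:
  assumes "m = card (edges (hypercube n))" "3 \<le> m"
    "bob_check n m cs []"
    "no_failure (\<lambda>x. bob_check n m ds [(replicate n False, x)]) [0..<Suc (m div 2)]"
  shows "bob_wins (hypercube n) first Map.empty"
proof (cases first)
  case Alice
  have "bob_wins (hypercube n) Bob [replicate n False \<mapsto> x]" if "x \<le> m div 2" for x
  proof -
    have "x \<in> set [0..<Suc (m div 2)]" using that by (simp del: upt_Suc)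
    hence "bob_check n m ds [(replicate n False, x)]" using assms(4) unfolding no_failure_iff by blast
    thus ?thesis
      using bob_check_sound[OF assms(1,2), of "[(replicate n False, x)]"] by (simp add: labelling_def)
  qed
  thus ?thesis using bob_wins_Alice_first assms(1) Alice by blast
next
  case Bob
  thus ?thesis using bob_check_sound[OF assms(1,2) _ assms(3)] by (simp add: labelling_def)
qed

lemma square_bob_wins: "bob_wins (hypercube 2) first Map.empty"
proof (rule hypercube_bob_wins_if_check[OF _ _ square_check])
  show "4 = card (edges (hypercube 2))"
    using card_edges_hypercube[of 1] by (simp add: eval_nat_numeral)
qed simp

lemma cube_bob_wins: "bob_wins (hypercube 3) first Map.empty"
proof (rule hypercube_bob_wins_if_check[OF _ _ cube_check])
  show "12 = card (edges (hypercube 3))"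
    using card_edges_hypercube[of 2] by (simp add: eval_nat_numeral)
qed simp

theorem theorem11:
  fixes n :: nat and first :: player
  assumes "n \<ge> 2"
  shows "\<exists>\<sigma>. bob_winning_strategy (hypercube n) first \<sigma>"
proof (rule bob_winning_strategy_if_bob_wins)
  consider "n = 2" | "n = 3" | "4 \<le> n" using assms by linarith
  thus "bob_wins (hypercube n) first Map.empty"
    using square_bob_wins cube_bob_wins hypercube_bob_wins_large by cases auto
qed

end
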